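(* If $p(\lambda)\in\mathbb{Z}[\lambda]$ is a monic reciprocal polynomial of degree $4$ with nonzero discriminant $\operatorname{disc}(p)\ne0$, then $V_p(4)$ contains at most finitely many integral $B_4$-orbits; that is, the set of points of $V_p(4)$ with integer matrix entries is a union of at most finitely many $B_4$-orbits.
   Context: A Stokes matrix of rank $r$ is an $r\times r$ unipotent upper triangular matrix; $V(r)$ is the (complex) affine space of Stokes matrices of rank $r$. A polynomial $p$ of degree $r$ is reciprocal if $p(\lambda)=\lambda^rp(1/\lambda)$. For a monic reciprocal polynomial $p$ of degree $r$, $$V_p(r)=\{s\in V(r):\det(\lambda+s^{-1}s^T)=p(\lambda)\}.$$ A point of $V(r)$ is integral if the corresponding Stokes matrix has integer entries. $B_r$ is the braid group with standard generators $\sigma_1,\dots,\sigma_{r-1}$ and relations $\sigma_i\sigma_j=\sigma_j\sigma_i$ for $|i-j|\ge 2$, $\sigma_i\sigma_j\sigma_i=\sigma_j\sigma_i\sigma_j$ for $|i-j|=1$. It acts on $V(r)$ by $$\sigma_i s=\begin{bmatrix}I_{i-1}&&&\\&s_{i,i+1}&-1&\\&1&0&\\&&&I_{r-i-1}\end{bmatrix}\cdot s\cdot\begin{bmatrix}I_{i-1}&&&\\&s_{i,i+1}&1&\\&-1&0&\\&&&I_{r-i-1}\end{bmatrix},$$ where $s_{i,i+1}$ is the $(i,i+1)$ entry of $s$ and $I_k$ is the identity matrix of size $k$. This action preserves each $V_p(r)$ and preserves integrality. *)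

theory Defs
  imports
    "HOL-Algebra.Group_Action"
    "Jordan_Normal_Form.Gauss_Jordan_Elimination"
    "Subresultants.Resultant_Prelim"
begin

section \<open>Groups given by generators and relations\<close>

text \<open>A letter \<open>(x, True)\<close> stands for the generator \<open>x\<close>, a letter \<open>(x, False)\<close> for its inverse.\<close>

type_synonym 'g gword = "('g \<times> bool) list"

definition gwords :: "'g set \<Rightarrow> 'g gword set" where
  "gwords X = lists (X \<times> UNIV)"

inductive gword_eq :: "'g set \<Rightarrow> ('g gword \<times> 'g gword) set \<Rightarrow> 'g gword \<Rightarrow> 'g gword \<Rightarrow> bool"
  for X R where
  refl: "u \<in> gwords X \<Longrightarrow> gword_eq X R u u"
| sym: "gword_eq X R u v \<Longrightarrow> gword_eq X R v u"
| trans: "gword_eq X R u v \<Longrightarrow> gword_eq X R v w \<Longrightarrow> gword_eq X R u w"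
| cancel: "u \<in> gwords X \<Longrightarrow> v \<in> gwords X \<Longrightarrow> x \<in> X \<Longrightarrow>
    gword_eq X R (u @ [(x, b), (x, \<not> b)] @ v) (u @ v)"
| relation: "u \<in> gwords X \<Longrightarrow> v \<in> gwords X \<Longrightarrow> a \<in> gwords X \<Longrightarrow> b \<in> gwords X \<Longrightarrow> (a, b) \<in> R \<Longrightarrow>
    gword_eq X R (u @ a @ v) (u @ b @ v)"

definition gword_rel :: "'g set \<Rightarrow> ('g gword \<times> 'g gword) set \<Rightarrow> ('g gword \<times> 'g gword) set" where
  "gword_rel X R = {(u, v). gword_eq X R u v}"

definition presented_group :: "'g set \<Rightarrow> ('g gword \<times> 'g gword) set \<Rightarrow> 'g gword set monoid" where
  "presented_group X R =
    \<lparr>carrier = gwords X // gword_rel X R,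
     monoid.mult = (\<lambda>A B. \<Union>u\<in>A. \<Union>v\<in>B. gword_rel X R `` {u @ v}),
     one = gword_rel X R `` {[]}\<rparr>"

lemma gwords_simps [simp]:
  "[] \<in> gwords X"
  "(x, b) # u \<in> gwords X \<longleftrightarrow> x \<in> X \<and> u \<in> gwords X"
  "u @ v \<in> gwords X \<longleftrightarrow> u \<in> gwords X \<and> v \<in> gwords X"
  by (auto simp: gwords_def)

lemma gword_eq_gwords: "gword_eq X R u v \<Longrightarrow> u \<in> gwords X \<and> v \<in> gwords X"
  by (induction rule: gword_eq.induct) auto

lemma gword_eq_append_left:
  "gword_eq X R u v \<Longrightarrow> c \<in> gwords X \<Longrightarrow> gword_eq X R (c @ u) (c @ v)"
proof (induction rule: gword_eq.induct)
  case (cancel u v x b)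
  then show ?case using gword_eq.cancel[of "c @ u" X v x R b] by simp
next
  case (relation u v a b)
  then show ?case using gword_eq.relation[of "c @ u" X v a b R] by simp
qed (auto intro: gword_eq.intros)

lemma gword_eq_append_right:
  "gword_eq X R u v \<Longrightarrow> c \<in> gwords X \<Longrightarrow> gword_eq X R (u @ c) (v @ c)"
proof (induction rule: gword_eq.induct)
  case (cancel u v x b)
  then show ?case using gword_eq.cancel[of u X "v @ c" x R b] by simp
next
  case (relation u v a b)
  then show ?case using gword_eq.relation[of u X "v @ c" a b R] by simp
qed (auto intro: gword_eq.intros)

lemma gword_eq_append:
  assumes "gword_eq X R u u'" "gword_eq X R v v'"
  shows "gword_eq X R (u @ v) (u' @ v')"
  using gword_eq_append_right[OF assms(1)] gword_eq_append_left[OF assms(2)]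
    gword_eq_gwords[OF assms(1)] gword_eq_gwords[OF assms(2)]
  by (blast intro: gword_eq.trans)

lemma equiv_gword_rel: "equiv (gwords X) (gword_rel X R)"
  by (rule equivI)
    (auto simp: gword_rel_def refl_on_def sym_def trans_def
      dest: gword_eq_gwords intro: gword_eq.intros)

definition gword_class :: "'g set \<Rightarrow> ('g gword \<times> 'g gword) set \<Rightarrow> 'g gword \<Rightarrow> 'g gword set" where
  "gword_class X R u = gword_rel X R `` {u}"

lemma gword_class_eq_iff:
  "u \<in> gwords X \<Longrightarrow> v \<in> gwords X \<Longrightarrow> gword_class X R u = gword_class X R v \<longleftrightarrow> gword_eq X R u v"
  using eq_equiv_class_iff[OF equiv_gword_rel] by (fastforce simp: gword_class_def gword_rel_def)

lemma carrier_presented_group: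
  "carrier (presented_group X R) = gword_class X R ` gwords X"
  by (auto simp: presented_group_def quotient_def gword_class_def)

lemma one_presented_group: "\<one>\<^bsub>presented_group X R\<^esub> = gword_class X R []"
  by (simp add: presented_group_def gword_class_def)

lemma mult_presented_group:
  assumes "u \<in> gwords X" "v \<in> gwords X"
  shows "gword_class X R u \<otimes>\<^bsub>presented_group X R\<^esub> gword_class X R v = gword_class X R (u @ v)"
proof -
  have *: "gword_class X R (u' @ v') = gword_class X R (u @ v)"
    if "u' \<in> gword_class X R u" "v' \<in> gword_class X R v" for u' v'
  proof -
    have "gword_eq X R u u'" "gword_eq X R v v'"
      using that by (auto simp: gword_class_def gword_rel_def)
    then have "gword_eq X R (u' @ v') (u @ v)"
      by (blast intro: gword_eq.sym gword_eq_append)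
    then show ?thesis
      using gword_class_eq_iff gword_eq_gwords by blast
  qed
  have "u \<in> gword_class X R u" "v \<in> gword_class X R v"
    using assms by (auto simp: gword_class_def gword_rel_def intro: gword_eq.refl)
  then have "(\<Union>u'\<in>gword_class X R u. \<Union>v'\<in>gword_class X R v. gword_class X R (u' @ v'))
      = gword_class X R (u @ v)"
    using * by blast
  then show ?thesis
    by (simp add: presented_group_def gword_class_def)
qed

definition gword_inv :: "'g gword \<Rightarrow> 'g gword" where
  "gword_inv u = rev (map (\<lambda>(x, b). (x, \<not> b)) u)"

lemma gword_inv_gwords: "u \<in> gwords X \<Longrightarrow> gword_inv u \<in> gwords X"
  by (induction u) (auto simp: gword_inv_def)

lemma gword_inv_left: "u \<in> gwords X \<Longrightarrow> gword_eq X R (gword_inv u @ u) []"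
proof (induction u)
  case Nil
  then show ?case by (auto simp: gword_inv_def intro: gword_eq.refl)
next
  case (Cons y u)
  obtain x b where y: "y = (x, b)" by force
  have u: "u \<in> gwords X" "x \<in> X" using Cons.prems y by auto
  have "gword_eq X R (gword_inv u @ [(x, \<not> b), (x, \<not> \<not> b)] @ u) (gword_inv u @ u)"
    by (rule gword_eq.cancel) (use u gword_inv_gwords in auto)
  then have "gword_eq X R (gword_inv (y # u) @ (y # u)) (gword_inv u @ u)"
    by (simp add: y gword_inv_def)
  then show ?case using Cons.IH u by (blast intro: gword_eq.trans)
qed

lemma group_presented_group: "group (presented_group X R)"
proof (rule groupI)
  fix A assume "A \<in> carrier (presented_group X R)"
  then obtain u where u: "u \<in> gwords X" "A = gword_class X R u"
    by (auto simp: carrier_presented_group)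
  then show "\<exists>B\<in>carrier (presented_group X R). B \<otimes>\<^bsub>presented_group X R\<^esub> A = \<one>\<^bsub>presented_group X R\<^esub>"
    by (intro bexI[of _ "gword_class X R (gword_inv u)"])
      (auto simp: mult_presented_group one_presented_group carrier_presented_group
        gword_inv_gwords gword_class_eq_iff gword_inv_left)
qed (auto simp: carrier_presented_group mult_presented_group one_presented_group)


section \<open>Stokes matrices and the braid group action\<close>

text \<open>Matrix entries are indexed from 0 in \<open>Jordan_Normal_Form\<close>, whereas the generators
  \<open>\<sigma>\<^sub>1, \<dots>, \<sigma>\<^sub>r\<^sub>-\<^sub>1\<close> are indexed from 1.\<close>

definition stokes :: "nat \<Rightarrow> complex mat set" where
  "stokes r = {s \<in> carrier_mat r r. upper_triangular s \<and> (\<forall>i<r. s $$ (i, i) = 1)}"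

lemma stokes_invertible:
  assumes "s \<in> stokes r"
  shows "\<exists>t. mat_inverse s = Some t"
proof (rule ccontr)
  have s: "s \<in> carrier_mat r r" "upper_triangular s" "\<forall>i<r. s $$ (i, i) = 1"
    using assms by (auto simp: stokes_def)
  then have "diag_mat s = replicate r 1"
    by (intro nth_equalityI) (auto simp: diag_mat_def)
  then have "det s \<noteq> 0"
    using det_upper_triangular[OF s(2,1)] by simp
  then have "s \<in> Units (ring_mat TYPE(complex) r ())"
    by (rule det_non_zero_imp_unit[OF s(1)])
  moreover assume "\<nexists>t. mat_inverse s = Some t"
  ultimately show False
    using mat_inverse(1)[OF s(1), where b = "()"] by auto
qed

definition integral_mat :: "complex mat \<Rightarrow> bool" where
  "integral_mat s \<longleftrightarrow> elements_mat s \<subseteq> \<int>"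

definition reciprocal_poly :: "complex poly \<Rightarrow> bool" where
  "reciprocal_poly p \<longleftrightarrow> (\<forall>x. x \<noteq> 0 \<longrightarrow> poly p x = x ^ degree p * poly p (1 / x))"

definition stokes_variety :: "nat \<Rightarrow> complex poly \<Rightarrow> complex mat set" where
  "stokes_variety r p = {s \<in> stokes r.
     \<forall>x. det (x \<cdot>\<^sub>m 1\<^sub>m r + the (mat_inverse s) * transpose_mat s) = poly p x}"

text \<open>The division below is exact: the leading coefficient divides the first column of the
  Sylvester matrix. For \<open>p = a \<Prod>\<^sub>i (\<lambda> - x\<^sub>i)\<close> of degree \<open>n\<close>
  this is \<open>a\<^bsup>2 n - 2\<^esup> \<Prod>\<^sub>i\<^sub><\<^sub>j (x\<^sub>i - x\<^sub>j)\<^sup>2\<close>.\<close>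

definition discriminant :: "int poly \<Rightarrow> int" where
  "discriminant p =
     (- 1) ^ (degree p * (degree p - 1) div 2) * resultant p (pderiv p) div lead_coeff p"

definition braid_relations :: "nat \<Rightarrow> (nat gword \<times> nat gword) set" where
  "braid_relations r =
     {([(i, True), (j, True)], [(j, True), (i, True)]) | i j.
        i \<in> {1..<r} \<and> j \<in> {1..<r} \<and> (i + 2 \<le> j \<or> j + 2 \<le> i)} \<union>
     {([(i, True), (j, True), (i, True)], [(j, True), (i, True), (j, True)]) | i j.
        i \<in> {1..<r} \<and> j \<in> {1..<r} \<and> (i = j + 1 \<or> j = i + 1)}"

definition braid_group :: "nat \<Rightarrow> nat gword set monoid" where
  "braid_group r = presented_group {1..<r} (braid_relations r)"

definition block2 :: "nat \<Rightarrow> nat \<Rightarrow> complex \<Rightarrow> complex \<Rightarrow> complex \<Rightarrow> complex \<Rightarrow> complex mat" where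
  "block2 r i a b c d =
     diag_block_mat [1\<^sub>m (i - 1), mat_of_rows_list 2 [[a, b], [c, d]], 1\<^sub>m (r - i - 1)]"

definition braid_gen :: "nat \<Rightarrow> nat \<Rightarrow> complex mat \<Rightarrow> complex mat" where
  "braid_gen r i s = (let a = s $$ (i - 1, i) in block2 r i a (-1) 1 0 * s * block2 r i a 1 (-1) 0)"

definition braid_word_act :: "nat \<Rightarrow> nat gword \<Rightarrow> complex mat \<Rightarrow> complex mat" where
  "braid_word_act r =
     foldr (\<lambda>(i, b). if b then braid_gen r i else inv_into (stokes r) (braid_gen r i))"

text \<open>The result does not depend on the word chosen to represent the braid, see
  \<open>braid_action_class\<close> below.\<close>

definition braid_action :: "nat \<Rightarrow> nat gword set \<Rightarrow> complex mat \<Rightarrow> complex mat" where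
  "braid_action r g = (\<lambda>s\<in>stokes r. braid_word_act r (SOME w. w \<in> g) s)"


subsection \<open>The action is well defined\<close>

lemma block2_carrier:
  "Suc p < r \<Longrightarrow> block2 r (Suc p) a b c d \<in> carrier_mat r r"
  unfolding block2_def carrier_mat_def by (auto simp: dim_diag_block_mat mat_of_rows_list_def)

lemma block2_dim [simp]:
  "Suc p < r \<Longrightarrow> dim_row (block2 r (Suc p) a b c d) = r"
  "Suc p < r \<Longrightarrow> dim_col (block2 r (Suc p) a b c d) = r"
  using block2_carrier by blast+

lemma block2_index:
  assumes "Suc p < r" "j < r" "k < r"
  shows "block2 r (Suc p) a b c d $$ (j, k) =
    (if j = p then (if k = p then a else if k = Suc p then b else 0)
     else if j = Suc p then (if k = p then c else if k = Suc p then d else 0)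
     else if j = k then 1 else 0)"
proof -
  let ?M = "mat_of_rows_list 2 [[a, b], [c, d]]"
  have "block2 r (Suc p) a b c d $$ (j, k) =
    (if j < p then if k < p then 1\<^sub>m p $$ (j, k) else 0
     else if k < p then 0
     else if j - p < 2 then if k - p < 2 then ?M $$ (j - p, k - p) else 0
     else if k - p < 2 then 0 else 1\<^sub>m (r - Suc p - 1) $$ (j - p - 2, k - p - 2))"
    using assms by (simp add: block2_def mat_of_rows_list_def Let_def)
  note e = this
  have M: "?M $$ (u, v) = (if u = 0 then if v = 0 then a else b else if v = 0 then c else d)"
    if "u < 2" "v < 2" for u v
    using that by (auto simp: mat_of_rows_list_def less_2_cases_iff)
  consider "j < p" | "j = p" | "j = Suc p" | "Suc p < j" by linarith
  then show ?thesis
  proof cases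
    case 4
    then have "\<not> j - p < 2" "\<not> j < p" "j \<noteq> p" "j \<noteq> Suc p" by auto
    with 4 assms show ?thesis
      by (cases "k < p"; cases "k - p < 2") (auto simp: e)
  next
    case 1
    with assms show ?thesis by (simp add: e)
  next
    case 2
    have "k = p \<or> k = Suc p" if "\<not> k < p" "k - p < 2" using that by linarith
    with 2 show ?thesis
      unfolding e by (cases "k < p"; cases "k - p < 2") (auto simp: M)
  next
    case 3
    have "k = p \<or> k = Suc p" if "\<not> k < p" "k - p < 2" using that by linarith
    with 3 show ?thesis
      unfolding e by (cases "k < p"; cases "k - p < 2") (auto simp: M)
  qed
qed

lemma block2_mult_index:
  assumes "Suc p < r" "M \<in> carrier_mat r n" "j < r" "k < n"
  shows "(block2 r (Suc p) a b c d * M) $$ (j, k) =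
    (if j = p then a * M $$ (p, k) + b * M $$ (Suc p, k)
     else if j = Suc p then c * M $$ (p, k) + d * M $$ (Suc p, k)
     else M $$ (j, k))"
proof -
  let ?B = "block2 r (Suc p) a b c d"
  have "(?B * M) $$ (j, k) = (\<Sum>l\<in>{0..<r}. ?B $$ (j, l) * M $$ (l, k))"
    using assms by (auto simp: scalar_prod_def)
  also have "\<dots> = (\<Sum>l\<in>{p, Suc p} \<union> {j}. ?B $$ (j, l) * M $$ (l, k))"
    by (rule sum.mono_neutral_right) (use assms in \<open>auto simp: block2_index\<close>)
  also have "\<dots> = (if j = p then a * M $$ (p, k) + b * M $$ (Suc p, k)
     else if j = Suc p then c * M $$ (p, k) + d * M $$ (Suc p, k)
     else M $$ (j, k))"
    using assms by (auto simp: block2_index insert_commute)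
  finally show ?thesis .
qed

lemma block2_transpose:
  assumes "Suc p < r"
  shows "transpose_mat (block2 r (Suc p) a b c d) = block2 r (Suc p) a c b d"
  by (rule eq_matI) (use assms in \<open>auto simp: block2_index\<close>)

lemma mult_block2_index:
  assumes "Suc p < r" "M \<in> carrier_mat n r" "j < n" "k < r"
  shows "(M * block2 r (Suc p) a c b d) $$ (j, k) =
    (if k = p then a * M $$ (j, p) + b * M $$ (j, Suc p)
     else if k = Suc p then c * M $$ (j, p) + d * M $$ (j, Suc p)
     else M $$ (j, k))"
proof -
  let ?B = "block2 r (Suc p) a b c d"
  have B: "?B \<in> carrier_mat r r" using assms by (simp add: block2_carrier)
  have "M * block2 r (Suc p) a c b d = transpose_mat (?B * transpose_mat M)"
    using assms B by (subst transpose_mult[of _ r r _ n]) (auto simp: block2_transpose)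
  then have "(M * block2 r (Suc p) a c b d) $$ (j, k) = (?B * transpose_mat M) $$ (k, j)"
    using assms B by auto
  then show ?thesis
    using assms block2_mult_index[of p r "transpose_mat M" n k j a b c d] by auto
qed

lemma stokesI:
  assumes "s \<in> carrier_mat r r" "\<And>i. i < r \<Longrightarrow> s $$ (i, i) = 1"
    "\<And>i j. i < r \<Longrightarrow> j < i \<Longrightarrow> s $$ (i, j) = 0"
  shows "s \<in> stokes r"
  using assms by (auto simp: stokes_def)

lemma stokesD:
  assumes "s \<in> stokes r"
  shows "s \<in> carrier_mat r r" "\<And>i. i < r \<Longrightarrow> s $$ (i, i) = 1"
    "\<And>i j. i < r \<Longrightarrow> j < i \<Longrightarrow> s $$ (i, j) = 0"
  using assms by (auto simp: stokes_def upper_triangular_def)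

definition braid_gen_inv :: "nat \<Rightarrow> nat \<Rightarrow> complex mat \<Rightarrow> complex mat" where
  "braid_gen_inv r i s = (let a = s $$ (i - 1, i) in block2 r i 0 1 (-1) a * s * block2 r i 0 (-1) 1 a)"

lemma block2_conj_index:
  assumes "Suc p < r" "s \<in> carrier_mat r r" "j < r" "k < r"
  shows "(block2 r (Suc p) a b c d * s * block2 r (Suc p) a c b d) $$ (j, k) =
   (let f = (\<lambda>l. if j = p then a * s $$ (p, l) + b * s $$ (Suc p, l)
     else if j = Suc p then c * s $$ (p, l) + d * s $$ (Suc p, l)
     else s $$ (j, l)) in
    (if k = p then a * f p + b * f (Suc p)
     else if k = Suc p then c * f p + d * f (Suc p)
     else f k))"
proof -
  have B: "block2 r (Suc p) a b c d * s \<in> carrier_mat r r"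
    using assms block2_carrier by (meson mult_carrier_mat)
  show ?thesis
    using assms by (subst mult_block2_index[OF assms(1) B assms(3,4)])
      (simp add: Let_def block2_mult_index[OF assms(1,2)] del: index_mult_mat(1))
qed

lemma braid_gen_carrier:
  assumes "Suc p < r" "s \<in> carrier_mat r r"
  shows "braid_gen r (Suc p) s \<in> carrier_mat r r" "braid_gen_inv r (Suc p) s \<in> carrier_mat r r"
  unfolding braid_gen_def braid_gen_inv_def Let_def
  using assms block2_carrier by (meson mult_carrier_mat)+

lemma braid_gen_index:
  assumes "Suc p < r" "s \<in> carrier_mat r r" "j < r" "k < r"
  shows "braid_gen r (Suc p) s $$ (j, k) =
   (let a = s $$ (p, Suc p);
      f = (\<lambda>l. if j = p then a * s $$ (p, l) - s $$ (Suc p, l)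
        else if j = Suc p then s $$ (p, l) else s $$ (j, l)) in
    (if k = p then a * f p - f (Suc p) else if k = Suc p then f p else f k))"
  unfolding braid_gen_def Let_def diff_Suc_1 block2_conj_index[OF assms] by simp

lemma braid_gen_inv_index:
  assumes "Suc p < r" "s \<in> carrier_mat r r" "j < r" "k < r"
  shows "braid_gen_inv r (Suc p) s $$ (j, k) =
   (let a = s $$ (p, Suc p);
      f = (\<lambda>l. if j = p then s $$ (Suc p, l)
        else if j = Suc p then a * s $$ (Suc p, l) - s $$ (p, l) else s $$ (j, l)) in
    (if k = p then f (Suc p) else if k = Suc p then a * f (Suc p) - f p else f k))"
  unfolding braid_gen_inv_def Let_def diff_Suc_1 block2_conj_index[OF assms] by simp

lemma braid_gen_stokes:
  assumes "Suc p < r" "s \<in> stokes r"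
  shows "braid_gen r (Suc p) s \<in> stokes r"
    "braid_gen r (Suc p) s $$ (p, Suc p) = s $$ (p, Suc p)"
    "braid_gen_inv r (Suc p) s \<in> stokes r"
    "braid_gen_inv r (Suc p) s $$ (p, Suc p) = s $$ (p, Suc p)"
proof -
  note s = stokesD[OF assms(2)]
  note idx = braid_gen_index[OF assms(1) s(1)] braid_gen_inv_index[OF assms(1) s(1)]
  show "braid_gen r (Suc p) s \<in> stokes r"
    by (rule stokesI) (use assms braid_gen_carrier s in \<open>auto simp: idx Let_def\<close>)
  show "braid_gen_inv r (Suc p) s \<in> stokes r"
    by (rule stokesI) (use assms braid_gen_carrier s in \<open>auto simp: idx Let_def\<close>)
  show "braid_gen r (Suc p) s $$ (p, Suc p) = s $$ (p, Suc p)"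
    "braid_gen_inv r (Suc p) s $$ (p, Suc p) = s $$ (p, Suc p)"
    using assms s by (auto simp: idx Let_def)
qed

lemma block2_inverse:
  assumes "Suc p < r"
  shows "block2 r (Suc p) a (-1) 1 0 * block2 r (Suc p) 0 1 (-1) a = 1\<^sub>m r"
    "block2 r (Suc p) 0 1 (-1) a * block2 r (Suc p) a (-1) 1 0 = 1\<^sub>m r"
    "block2 r (Suc p) a 1 (-1) 0 * block2 r (Suc p) 0 (-1) 1 a = 1\<^sub>m r"
    "block2 r (Suc p) 0 (-1) 1 a * block2 r (Suc p) a 1 (-1) 0 = 1\<^sub>m r"
  by (rule eq_matI;
      use assms block2_carrier in \<open>auto simp: block2_mult_index[where n = r] block2_index simp del: index_mult_mat(1)\<close>)+

lemma conj_conj: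
  fixes s :: "'a::comm_ring_1 mat"
  assumes "s \<in> carrier_mat r r" "A \<in> carrier_mat r r" "B \<in> carrier_mat r r"
    "C \<in> carrier_mat r r" "D \<in> carrier_mat r r"
  shows "A * (B * s * C) * D = (A * B) * s * (C * D)"
  using assms by (simp add: assoc_mult_mat[of _ r r _ r _ r] mult_carrier_mat[of _ r r _ r])

lemma braid_gen_inverse:
  assumes "Suc p < r" "s \<in> stokes r"
  shows "braid_gen r (Suc p) (braid_gen_inv r (Suc p) s) = s"
    "braid_gen_inv r (Suc p) (braid_gen r (Suc p) s) = s"
proof -
  note s = stokesD[OF assms(2)]
  note B = block2_carrier[OF assms(1)]
  note g = braid_gen_stokes[OF assms]
  show "braid_gen r (Suc p) (braid_gen_inv r (Suc p) s) = s"
    unfolding braid_gen_def[of _ _ "braid_gen_inv _ _ _"] Let_def diff_Suc_1 g(4)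
    unfolding braid_gen_inv_def Let_def diff_Suc_1
    using s assms by (subst conj_conj[OF s(1) B B B B]) (simp add: block2_inverse)
  show "braid_gen_inv r (Suc p) (braid_gen r (Suc p) s) = s"
    unfolding braid_gen_inv_def[of _ _ "braid_gen _ _ _"] Let_def diff_Suc_1 g(2)
    unfolding braid_gen_def Let_def diff_Suc_1
    using s assms by (subst conj_conj[OF s(1) B B B B]) (simp add: block2_inverse)
qed

lemma bij_betw_braid_gen:
  assumes "i \<in> {1..<r}"
  shows "bij_betw (braid_gen r i) (stokes r) (stokes r)"
proof -
  obtain p where i: "i = Suc p" "Suc p < r" using assms by (cases i) auto
  show ?thesis
    unfolding i
    by (rule bij_betw_byWitness[where f' = "braid_gen_inv r (Suc p)"])
      (use i braid_gen_stokes braid_gen_inverse in auto)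
qed

lemma braid_gen_commute:
  assumes "Suc q < r" "p + 2 \<le> q" "s \<in> stokes r"
  shows "braid_gen r (Suc p) (braid_gen r (Suc q) s) = braid_gen r (Suc q) (braid_gen r (Suc p) s)"
proof -
  have p: "Suc p < r" using assms by auto
  note s = stokesD[OF assms(3)]
  note B = block2_carrier[OF p] and C = block2_carrier[OF assms(1)]
  have e: "braid_gen r (Suc q) s $$ (p, Suc p) = s $$ (p, Suc p)"
    "braid_gen r (Suc p) s $$ (q, Suc q) = s $$ (q, Suc q)"
    using assms p s by (auto simp: Let_def braid_gen_index)
  have c: "block2 r (Suc p) a b c d * block2 r (Suc q) a' b' c' d' =
    block2 r (Suc q) a' b' c' d' * block2 r (Suc p) a b c d" for a b c d a' b' c' d'
    by (rule eq_matI) (use assms(1,2) p in \<open>auto simp: block2_mult_index[where n = r]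
      block2_carrier block2_index simp del: index_mult_mat(1)\<close>)
  show ?thesis
    unfolding braid_gen_def[of _ _ "braid_gen _ _ _"] Let_def diff_Suc_1 e
    unfolding braid_gen_def Let_def diff_Suc_1
    by (subst conj_conj[OF s(1) B C C B], subst conj_conj[OF s(1) C B B C])
      (simp add: c)
qed

lemma braid_gen_braid:
  assumes p: "Suc (Suc p) < r" and "s \<in> stokes r"
  shows "braid_gen r (Suc p) (braid_gen r (Suc (Suc p)) (braid_gen r (Suc p) s)) =
    braid_gen r (Suc (Suc p)) (braid_gen r (Suc p) (braid_gen r (Suc (Suc p)) s))"
proof -
  have p': "Suc p < r" using assms by auto
  let ?i = "Suc p" and ?j = "Suc (Suc p)"
  define L where "L = (\<lambda>i a. block2 r i a (-1) 1 0)"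
  define a where "a = s $$ (p, ?i)"
  define b where "b = s $$ (p, ?j)"
  define c where "c = s $$ (?i, ?j)"
  note s = stokesD[OF assms(2)]
  have L: "L ?i x \<in> carrier_mat r r" "L ?j x \<in> carrier_mat r r" for x
    using block2_carrier p p' by (auto simp: L_def)
  have gen: "braid_gen r ?i t = L ?i (t $$ (p, ?i)) * t * transpose_mat (L ?i (t $$ (p, ?i)))"
    "braid_gen r ?j t = L ?j (t $$ (?i, ?j)) * t * transpose_mat (L ?j (t $$ (?i, ?j)))" for t
    using p p' by (simp_all add: braid_gen_def L_def block2_transpose Let_def)
  note mem = braid_gen_carrier(1)[OF p' s(1)] braid_gen_carrier(1)[OF p s(1)]
  note idx = braid_gen_index
  have e1: "braid_gen r ?i s $$ (?i, ?j) = b" "braid_gen r ?i s $$ (p, ?i) = a"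
      "braid_gen r ?i s $$ (p, ?j) = a * b - c"
    using assms p' s by (auto simp: idx a_def b_def c_def Let_def)
  have e2: "braid_gen r ?j (braid_gen r ?i s) $$ (p, ?i) = c"
    using assms p' s mem by (simp add: idx[OF p mem(1)] Let_def e1)
  have f1: "braid_gen r ?j s $$ (p, ?i) = c * a - b" "braid_gen r ?j s $$ (?i, ?j) = c"
      "braid_gen r ?j s $$ (p, ?j) = a"
    using assms p' s by (auto simp: idx a_def b_def c_def Let_def)
  have f2: "braid_gen r ?i (braid_gen r ?j s) $$ (?i, ?j) = a"
    using assms p' s mem by (simp add: idx[OF p' mem(2)] Let_def f1)
  have triple: "A * (B * (C * s * transpose_mat C) * transpose_mat B) * transpose_mat A =
      (A * (B * C)) * s * transpose_mat (A * (B * C))"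
    if "A \<in> carrier_mat r r" "B \<in> carrier_mat r r" "C \<in> carrier_mat r r" for A B C
    using that s(1)
    by (simp add: transpose_mult[of _ r r _ r] assoc_mult_mat[of _ r r _ r _ r]
        mult_carrier_mat[of _ r r _ r])
  have P: "L ?i c * (L ?j b * L ?i a) = L ?j a * (L ?i (c * a - b) * L ?j c)"
  proof (rule eq_matI)
    fix j k assume "j < dim_row (L ?j a * (L ?i (c * a - b) * L ?j c))"
      "k < dim_col (L ?j a * (L ?i (c * a - b) * L ?j c))"
    then have jk: "j < r" "k < r" using p p' by (auto simp: L_def)
    have m: "block2 r ?i x y z w * block2 r ?j x' y' z' w' \<in> carrier_mat r r"
      "block2 r ?j x y z w * block2 r ?i x' y' z' w' \<in> carrier_mat r r" for x y z w x' y' z' w'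
      using block2_carrier p p' by (meson mult_carrier_mat)+
    show "(L ?i c * (L ?j b * L ?i a)) $$ (j, k) = (L ?j a * (L ?i (c * a - b) * L ?j c)) $$ (j, k)"
      using jk p p' unfolding L_def
      by (auto simp: block2_mult_index[where n = r] block2_carrier m block2_index algebra_simps
          simp del: index_mult_mat(1))
  qed (use p p' in \<open>auto simp: L_def\<close>)
  have "braid_gen r ?i (braid_gen r ?j (braid_gen r ?i s)) =
      (L ?i c * (L ?j b * L ?i a)) * s * transpose_mat (L ?i c * (L ?j b * L ?i a))"
    unfolding gen(1)[of "braid_gen r ?j (braid_gen r ?i s)"] e2
    unfolding gen(2)[of "braid_gen r ?i s"] e1
    unfolding gen(1)[of s] a_def[symmetric]
    by (rule triple; rule L)
  moreover have "braid_gen r ?j (braid_gen r ?i (braid_gen r ?j s)) =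
      (L ?j a * (L ?i (c * a - b) * L ?j c)) * s * transpose_mat (L ?j a * (L ?i (c * a - b) * L ?j c))"
    unfolding gen(2)[of "braid_gen r ?i (braid_gen r ?j s)"] f2
    unfolding gen(1)[of "braid_gen r ?j s"] f1
    unfolding gen(2)[of s] c_def[symmetric]
    by (rule triple; rule L)
  ultimately show ?thesis by (simp add: P)
qed

lemma braid_word_act_simps [simp]:
  "braid_word_act r [] s = s"
  "braid_word_act r ((i, b) # w) s =
    (if b then braid_gen r i (braid_word_act r w s)
     else inv_into (stokes r) (braid_gen r i) (braid_word_act r w s))"
  "braid_word_act r (u @ v) s = braid_word_act r u (braid_word_act r v s)"
  by (simp_all add: braid_word_act_def)

lemma braid_word_act_stokes:
  "w \<in> gwords {1..<r} \<Longrightarrow> s \<in> stokes r \<Longrightarrow> braid_word_act r w s \<in> stokes r"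
proof (induction w)
  case (Cons y w)
  obtain i b where y: "y = (i, b)" by force
  then have i: "i \<in> {1..<r}" and w: "w \<in> gwords {1..<r}" using Cons.prems by auto
  note bij = bij_betw_braid_gen[OF i]
  show ?case
    using Cons.IH[OF w Cons.prems(2)] bij bij_betw_inv_into[OF bij] y
    by (auto simp: bij_betw_def)
qed simp

lemma braid_word_act_eq:
  assumes "gword_eq {1..<r} (braid_relations r) u v" "s \<in> stokes r"
  shows "braid_word_act r u s = braid_word_act r v s"
  using assms
proof (induction arbitrary: s rule: gword_eq.induct)
  case (cancel u v x b)
  note bij = bij_betw_braid_gen[OF cancel.hyps(3)]
  have v: "braid_word_act r v s \<in> stokes r" using cancel braid_word_act_stokes by blast
  show ?case
    using bij_betw_inv_into_left[OF bij v] bij_betw_inv_into_right[OF bij v] by simp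
next
  case (relation u v a b)
  have v: "braid_word_act r v s \<in> stokes r" using relation braid_word_act_stokes by blast
  have "braid_word_act r a t = braid_word_act r b t" if t: "t \<in> stokes r" for t
    using relation.hyps(5) unfolding braid_relations_def
  proof (elim UnE CollectE exE conjE disjE)
    fix i j assume *: "(a, b) = ([(i, True), (j, True)], [(j, True), (i, True)])"
      "i \<in> {1..<r}" "j \<in> {1..<r}" "i + 2 \<le> j"
    then obtain p q where "i = Suc p" "j = Suc q" by (cases i; cases j) auto
    then show ?thesis using braid_gen_commute[of q r p t] * t by simp
  next
    fix i j assume *: "(a, b) = ([(i, True), (j, True)], [(j, True), (i, True)])"
      "i \<in> {1..<r}" "j \<in> {1..<r}" "j + 2 \<le> i"
    then obtain p q where "i = Suc p" "j = Suc q" by (cases i; cases j) auto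
    then show ?thesis using braid_gen_commute[of p r q t] * t by simp
  next
    fix i j assume *: "(a, b) = ([(i, True), (j, True), (i, True)], [(j, True), (i, True), (j, True)])"
      "i \<in> {1..<r}" "j \<in> {1..<r}" "i = j + 1"
    then obtain q where "j = Suc q" by (cases j) auto
    then show ?thesis using braid_gen_braid[of q r t] * t by simp
  next
    fix i j assume *: "(a, b) = ([(i, True), (j, True), (i, True)], [(j, True), (i, True), (j, True)])"
      "i \<in> {1..<r}" "j \<in> {1..<r}" "j = i + 1"
    then obtain q where "i = Suc q" by (cases i) auto
    then show ?thesis using braid_gen_braid[of q r t] * t by simp
  qed
  then show ?case using v by simp
qed auto

abbreviation braid_class :: "nat \<Rightarrow> nat gword \<Rightarrow> nat gword set" where
  "braid_class r \<equiv> gword_class {1..<r} (braid_relations r)"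

lemma braid_action_class:
  assumes "w \<in> gwords {1..<r}" "s \<in> stokes r"
  shows "braid_action r (braid_class r w) s = braid_word_act r w s"
proof -
  have "w \<in> braid_class r w"
    using assms by (auto simp: gword_class_def gword_rel_def intro: gword_eq.refl)
  then have "(SOME u. u \<in> braid_class r w) \<in> braid_class r w" by (rule someI)
  then have "gword_eq {1..<r} (braid_relations r) w (SOME u. u \<in> braid_class r w)"
    by (simp add: gword_class_def gword_rel_def)
  then show ?thesis
    using braid_word_act_eq assms(2) by (simp add: braid_action_def)
qed

corollary braid_action_generator:
  "i \<in> {1..<r} \<Longrightarrow> s \<in> stokes r \<Longrightarrow> braid_action r (braid_class r [(i, True)]) s = braid_gen r i s"
  by (simp add: braid_action_class del: One_nat_def)

lemma bij_betw_braid_word_act: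
  "w \<in> gwords {1..<r} \<Longrightarrow> bij_betw (braid_word_act r w) (stokes r) (stokes r)"
proof (induction w)
  case Nil
  have "braid_word_act r [] = id" by (auto simp: fun_eq_iff)
  then show ?case by (simp only: bij_betw_id)
next
  case (Cons y w)
  obtain i b where y: "y = (i, b)" by force
  then have i: "i \<in> {1..<r}" and w: "w \<in> gwords {1..<r}" using Cons.prems by auto
  note bij = bij_betw_braid_gen[OF i]
  have "bij_betw ((if b then braid_gen r i else inv_into (stokes r) (braid_gen r i)) \<circ>
      braid_word_act r w) (stokes r) (stokes r)"
    using bij bij_betw_inv_into[OF bij] by (intro bij_betw_trans[OF Cons.IH[OF w]]) simp
  moreover have "(if b then braid_gen r i else inv_into (stokes r) (braid_gen r i)) \<circ>
      braid_word_act r w = braid_word_act r (y # w)"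
    by (auto simp: fun_eq_iff y)
  ultimately show ?case by simp
qed

theorem group_action_braid: "group_action (braid_group r) (stokes r) (braid_action r)"
proof (intro group_action.intro group_hom.intro group_hom_axioms.intro homI)
  show "group (braid_group r)" by (simp add: braid_group_def group_presented_group)
  show "group (BijGroup (stokes r))" by (rule group_BijGroup)
  have bij: "braid_action r g \<in> Bij (stokes r)" if g: "g \<in> carrier (braid_group r)" for g
  proof -
    obtain w where w: "w \<in> gwords {1..<r}" "g = braid_class r w"
      using g by (auto simp: braid_group_def carrier_presented_group simp del: One_nat_def)
    have "bij_betw (braid_action r g) (stokes r) (stokes r)"
      using bij_betw_braid_word_act[OF w(1)] braid_action_class[OF w(1)] w(2)
      by (auto cong: bij_betw_cong)
    then show ?thesis by (simp add: Bij_def braid_action_def)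
  qed
  then show "braid_action r g \<in> carrier (BijGroup (stokes r))" if "g \<in> carrier (braid_group r)" for g
    using that by (simp add: BijGroup_def)
  fix g h assume gh: "g \<in> carrier (braid_group r)" "h \<in> carrier (braid_group r)"
  then obtain u v where u: "u \<in> gwords {1..<r}" "g = braid_class r u"
    and v: "v \<in> gwords {1..<r}" "h = braid_class r v"
    by (auto simp: braid_group_def carrier_presented_group simp del: One_nat_def)
  have "braid_action r (braid_class r (u @ v)) = compose (stokes r) (braid_action r g) (braid_action r h)"
  proof (rule extensionalityI)
    fix s assume "s \<in> stokes r"
    then show "braid_action r (braid_class r (u @ v)) s =
        compose (stokes r) (braid_action r g) (braid_action r h) s"
      using u v by (simp add: compose_eq braid_action_class braid_word_act_stokes del: One_nat_def)
  qed (simp_all add: braid_action_def compose_def)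
  then show "braid_action r (g \<otimes>\<^bsub>braid_group r\<^esub> h) =
      braid_action r g \<otimes>\<^bsub>BijGroup (stokes r)\<^esub> braid_action r h"
    using bij[OF gh(1)] bij[OF gh(2)] u v
    by (simp add: braid_group_def mult_presented_group BijGroup_def del: One_nat_def)
qed

end

theory Submission
  imports Defs "Subresultants.Subresultant_Gcd"
begin

text \<open>
  A Stokes matrix \<open>s\<close> of rank 4 is the table of products \<open>s\<^sub>i\<^sub>j = (e\<^sub>i, e\<^sub>j)\<close> of four vectors with
  \<open>(e\<^sub>i, e\<^sub>i) = 2\<close>, and \<open>\<sigma>\<^sub>i\<close> replaces the neighbours \<open>e\<^sub>i, e\<^sub>i\<^sub>+\<^sub>1\<close> by
  \<open>s\<^sub>i\<^sub>,\<^sub>i\<^sub>+\<^sub>1 e\<^sub>i - e\<^sub>i\<^sub>+\<^sub>1, e\<^sub>i\<close>. The polynomial fixes two numbers: the trace coefficient \<open>4 - q\<close>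
  and, up to sign, the Pfaffian \<open>p\<close> of \<open>s - s\<^sup>T\<close>. The values of the polynomial at \<open>-1\<close> and \<open>1\<close> are \<open>p\<^sup>2\<close> and
  \<open>p\<^sup>2 - 4 q + 16\<close>. A reciprocal quartic vanishing at \<open>1\<close> or \<open>-1\<close> has a double root there, so the
  discriminant hypothesis makes both numbers nonzero.

  The proof is a descent on the Markov invariant
  \<open>K = x\<^sup>2 + y\<^sup>2 + z\<^sup>2 - x y z\<close> of the first three vectors, where \<open>x, y, z\<close> are the consecutive products
  along the sequence \<open>e\<^sub>1, e\<^sub>2, e\<^sub>3, e\<^sub>1', e\<^sub>2', \<dots>\<close> obtained by braiding each of the three vectors past the
  other two, here called the helix. Braids that move only these three vectors shift \<open>e\<^sub>4\<close> along that sequence. Dropping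
  \<open>e\<^sub>1\<close> in favour of \<open>e\<^sub>4\<close> gives a triple whose invariant \<open>L\<close> satisfies
  \<open>K L = D\<^sup>2 - p y H + p\<^sup>2 + q y\<^sup>2\<close> (\<open>markov_product\<close>), where \<open>D\<close> and \<open>H\<close> are the difference and
  the sum of the products of \<open>e\<^sub>4\<close> with \<open>e\<^sub>1\<close> and with its translate \<open>e\<^sub>1'\<close>. Along the shifts by a
  full period, \<open>D\<close> obeys a linear recurrence with trace \<open>2 - K\<close> and an invariant quadratic form
  (\<open>twist_linear\<close>, \<open>gap_quadratic\<close>), so it can be made small. If \<open>|K|\<close> and then \<open>|x| + |y| + |z|\<close> are minimal
  in the orbit, either a smaller triple is found, which is impossible, or \<open>x, y, z\<close> are bounded in
  terms of \<open>p\<close> and \<open>q\<close> alone (\<open>descent_positive\<close>, \<open>descent_negative\<close>, \<open>reduced_bounded\<close>).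

  Once \<open>x, y, z\<close> are bounded, a last shift bounds \<open>D\<close>; then \<open>H\<close> is bounded by the relation \<open>height_equation\<close>,
  and \<open>x, y, z, D, H\<close> determine the whole matrix when \<open>K \<noteq> y\<^sup>2\<close> (\<open>last_coordinates\<close>). The
  degenerate values of the twist are \<open>K = 0\<close> and \<open>K = 4\<close>; there boundedness comes from \<open>p \<noteq> 0\<close> and
  \<open>p\<^sup>2 - 4 q + 16 \<noteq> 0\<close>. Hence every orbit meets one of two explicit finite sets (\<open>orbit_representative\<close>,
  \<open>finite_representatives\<close>), one for each sign of the Pfaffian.
\<close>

section \<open>Integral Stokes matrices in helix coordinates\<close>

text \<open>The tuple \<open>(x, y, z, u, v, w)\<close> stands for the Stokes matrix with
  \<open>s\<^sub>1\<^sub>2 = x\<close>, \<open>s\<^sub>2\<^sub>3 = y\<close>, \<open>s\<^sub>1\<^sub>3 = x y - z\<close> and last column \<open>u, v, w\<close>. With \<open>z\<close> in place of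
  \<open>s\<^sub>1\<^sub>3\<close> the move \<open>\<sigma>\<^sub>2\<^sup>-\<^sup>1 \<sigma>\<^sub>1\<^sup>-\<^sup>1\<close>, which carries \<open>e\<^sub>1\<close> past \<open>e\<^sub>2\<close> and \<open>e\<^sub>3\<close>, permutes \<open>x, y, z\<close> cyclically.\<close>

type_synonym state = "int \<times> int \<times> int \<times> int \<times> int \<times> int"

fun rot :: "state \<Rightarrow> state" where
  "rot (x, y, z, u, v, w) = (y, z, x, v, w, u - x * v + z * w)"

fun rotinv :: "state \<Rightarrow> state" where
  "rotinv (x, y, z, u, v, w) = (z, x, y, w - y * v + z * u, u, v)"

fun vieta :: "state \<Rightarrow> state" where
  "vieta (x, y, z, u, v, w) = (x, x * y - z, y, x * u - v, u, w)"

fun markov :: "state \<Rightarrow> int" where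
  "markov (x, y, z, u, v, w) = x\<^sup>2 + y\<^sup>2 + z\<^sup>2 - x * y * z"

text \<open>The next two functions are the Pfaffian of \<open>s - s\<^sup>T\<close> and the number \<open>q\<close> for which the characteristic
  polynomial has \<open>\<lambda>\<^sup>3\<close>-coefficient \<open>4 - q\<close>.\<close>

fun pfaffian :: "state \<Rightarrow> int" where
  "pfaffian (x, y, z, u, v, w) = y * u - (x * y - z) * v + x * w"

fun cotrace :: "state \<Rightarrow> int" where
  "cotrace (x, y, z, u, v, w) =
     markov (x, y, z, u, v, w) + u\<^sup>2 + v\<^sup>2 + w\<^sup>2 - x * u * v - y * v * w + z * u * w"

text \<open>Difference and sum of the products of \<open>e\<^sub>4\<close> with \<open>e\<^sub>1\<close> and with the vector that follows
  \<open>e\<^sub>1, e\<^sub>2, e\<^sub>3\<close> in the helix; the latter product is \<open>u - x v + z w\<close>.\<close>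

fun gap :: "state \<Rightarrow> int" where
  "gap (x, y, z, u, v, w) = x * v - z * w"

fun height :: "state \<Rightarrow> int" where
  "height (x, y, z, u, v, w) = 2 * u - x * v + z * w"

fun size3 :: "state \<Rightarrow> int" where
  "size3 (x, y, z, u, v, w) = \<bar>x\<bar> + \<bar>y\<bar> + \<bar>z\<bar>"

text \<open>Up to a factor depending on \<open>k\<close> only, this is the norm of the projection of \<open>e\<^sub>4\<close> to the plane
  on which the monodromy of the first three vectors acts, when their Markov invariant is \<open>k\<close>. At
  \<open>k = 0\<close> and \<open>k = 4\<close> it takes the values
  \<open>p\<^sup>2\<close> and \<open>p\<^sup>2 - 4 q + 16\<close> of the characteristic polynomial at \<open>-1\<close> and \<open>1\<close>.\<close>

definition twist_norm :: "int \<Rightarrow> int \<Rightarrow> int \<Rightarrow> int" where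
  "twist_norm p q k = k\<^sup>2 - q * k + p\<^sup>2"

lemma rotinv_rot [simp]: "rotinv (rot t) = t"
  by (cases t) (simp add: algebra_simps)

lemma rot_rotinv [simp]: "rot (rotinv t) = t"
  by (cases t) (simp add: algebra_simps)

lemma markov_rot [simp]: "markov (rot t) = markov t" "markov (rotinv t) = markov t"
  by (cases t; simp)+

lemma size3_rot [simp]: "size3 (rot t) = size3 t" "size3 (rotinv t) = size3 t"
  by (cases t; simp)+

lemma markov_vieta [simp]: "markov (vieta t) = markov t"
  by (cases t) (simp add: algebra_simps power2_eq_square)

lemma rot_cube: "rot (rot (rot (x, y, z, u, v, w))) =
   (x, y, z, u - x * v + z * w, v - y * w + x * (u - x * v + z * w),
    w - z * (u - x * v + z * w) + y * (v - y * w + x * (u - x * v + z * w)))"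
  by simp

lemma rotinv_cube: "rotinv (rotinv (rotinv (x, y, z, u, v, w))) =
   (x, y, z,
    u - z * (w - y * v + z * u) + x * (v - x * u + y * (w - y * v + z * u)),
    v - x * u + y * (w - y * v + z * u), w - y * v + z * u)"
  by (simp add: algebra_simps)

section \<open>Polynomial identities of the descent\<close>

text \<open>The second factor is the Markov invariant of \<open>e\<^sub>2, e\<^sub>3, e\<^sub>4\<close>. For fixed \<open>y\<close> the two Markov invariants are
  the roots of one quadratic polynomial, whose coefficients involve, besides \<open>y, p, q\<close>, only the products of \<open>e\<^sub>4\<close> with \<open>e\<^sub>1\<close> and
  with its translate; this lemma and the next one are its Vieta relations.\<close>

lemma markov_product:
  assumes "t = (x, y, z, u, v, w)" and "pfaffian t = p" and "cotrace t = q"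
  shows "markov t * (y\<^sup>2 + v\<^sup>2 + w\<^sup>2 - y * v * w) =
    (gap t)\<^sup>2 - p * y * height t + p\<^sup>2 + q * y\<^sup>2"
  unfolding assms(2,3)[symmetric] assms(1) by (simp add: algebra_simps power2_eq_square)

lemma markov_sum:
  assumes "t = (x, y, z, u, v, w)" and "cotrace t = q"
  shows "markov t + (y\<^sup>2 + v\<^sup>2 + w\<^sup>2 - y * v * w) = q + y\<^sup>2 - u * (u - gap t)"
  unfolding assms(2)[symmetric] assms(1) by (simp add: algebra_simps power2_eq_square)

text \<open>The quadratic equation satisfied by the Markov invariant \<open>k\<close>, multiplied by \<open>4 k\<close> and completed
  to a square. It bounds the height once \<open>k\<close>, \<open>y\<close> and the gap are bounded and \<open>k \<noteq> 0\<close>.\<close>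

lemma height_equation:
  assumes t: "t = (x, y, z, u, v, w)" and p: "pfaffian t = p" and q: "cotrace t = q"
  defines "k \<equiv> markov t"
  shows "(k * height t - 2 * p * y)\<^sup>2 = k * (k - 4) * (gap t)\<^sup>2 + 4 * (y\<^sup>2 - k) * twist_norm p q k"
proof -
  define l where "l = y\<^sup>2 + v\<^sup>2 + w\<^sup>2 - y * v * w"
  define d h where "d = gap t" and "h = height t"
  have h: "h = 2 * u - d" by (simp add: h_def d_def t)
  have s: "l = q + y\<^sup>2 - u * (u - d) - k" and m: "k * l = d\<^sup>2 - p * y * h + p\<^sup>2 + q * y\<^sup>2"
    using markov_sum[OF t q] markov_product[OF t p q] by (simp_all add: k_def l_def d_def h_def)
  have "(k * h - 2 * p * y)\<^sup>2 - (k * (k - 4) * d\<^sup>2 + 4 * (y\<^sup>2 - k) * twist_norm p q k) =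
    4 * k * (d\<^sup>2 - p * y * h + p\<^sup>2 + q * y\<^sup>2 - k * l)"
    unfolding h s twist_norm_def by (simp add: algebra_simps power2_eq_square)
  then have "(k * h - 2 * p * y)\<^sup>2 = k * (k - 4) * d\<^sup>2 + 4 * (y\<^sup>2 - k) * twist_norm p q k"
    using m by simp
  then show ?thesis by (simp add: d_def h_def)
qed

text \<open>Three rotations leave \<open>x, y, z\<close> alone and move \<open>e\<^sub>4\<close> by the monodromy of the triple. On the plane seen by
  the gap the monodromy has determinant 1 and trace \<open>2 - K\<close>.\<close>

lemma twist_linear:
  assumes "t = (x, y, z, u, v, w)"
  shows "gap (rot (rot (rot t))) + gap (rotinv (rotinv (rotinv t))) = (2 - markov t) * gap t"
  unfolding assms rot_cube rotinv_cube
  by (simp add: algebra_simps power2_eq_square)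

text \<open>The quadratic form preserved by the twist, written as a product of the two neighbours of a term of
  the sequence of gaps: with \<open>twist_linear\<close> it says that consecutive gaps \<open>d, d'\<close> satisfy
  \<open>d\<^sup>2 + d'\<^sup>2 - (2 - K) d d' = (y\<^sup>2 - K) twist_norm p q K\<close>.\<close>

lemma gap_quadratic:
  assumes t: "t = (x, y, z, u, v, w)" and p: "pfaffian t = p" and q: "cotrace t = q"
  defines "k \<equiv> markov t"
  shows "gap (rot (rot (rot t))) * gap (rotinv (rotinv (rotinv t))) = (gap t)\<^sup>2 - (y\<^sup>2 - k) * twist_norm p q k"
proof -
  define d where "d = gap t"
  define g where "g = u - d"
  have g: "g = u - x * v + z * w" by (simp add: g_def d_def t)
  have *: "gap (rot (rot (rot t))) = g + u - p * y + (k - 2) * g"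
    unfolding p[symmetric] k_def g t rot_cube by (simp add: algebra_simps power2_eq_square)
  have **: "gap (rotinv (rotinv (rotinv t))) = p * y - (k - 2) * u - g - u"
    unfolding p[symmetric] k_def g t rotinv_cube by (simp add: algebra_simps power2_eq_square)
  have h: "height t = u + g" by (simp add: g t)
  have gt: "gap t = u - g" by (simp add: g_def d_def)
  have l: "y\<^sup>2 + v\<^sup>2 + w\<^sup>2 - y * v * w = q + y\<^sup>2 - u * g - k"
    using markov_sum[OF t q] by (simp add: k_def gt algebra_simps)
  have s: "k * (q + y\<^sup>2 - u * g - k) = (u - g)\<^sup>2 - p * y * (u + g) + p\<^sup>2 + q * y\<^sup>2"
    using markov_product[OF t p q] by (simp only: l h gt k_def[symmetric])
  have "(g + u - p * y + (k - 2) * g) * (p * y - (k - 2) * u - g - u) -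
      ((u - g)\<^sup>2 - (y\<^sup>2 - k) * twist_norm p q k) =
    k * (k * (q + y\<^sup>2 - u * g - k) - ((u - g)\<^sup>2 - p * y * (u + g) + p\<^sup>2 + q * y\<^sup>2))"
    unfolding twist_norm_def by (simp add: algebra_simps power2_eq_square)
  then show ?thesis unfolding * ** gt using s by simp
qed

text \<open>The same quadratic form in the basis given by the gaps of two states that differ by a single rotation.
  Here the cross term has a sign governed by \<open>z\<close>, which the full period does not see.\<close>

lemma gap_adjacent:
  assumes t: "t = (x, y, z, u, v, w)" and p: "pfaffian t = p" and q: "cotrace t = q"
  defines "k \<equiv> markov t"
  defines "e \<equiv> gap (rotinv t)"
  shows "e\<^sup>2 * (y\<^sup>2 - k) + e * gap t * (z * k - 2 * x * y) + (gap t)\<^sup>2 * (x\<^sup>2 - k) = z\<^sup>2 * twist_norm p q k"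
proof -
  define n where "n = u\<^sup>2 + v\<^sup>2 + w\<^sup>2 - x * u * v - y * v * w + z * u * w"
  have e: "e = z * u - y * v" and d: "gap t = x * v - z * w" by (simp_all add: e_def t)
  have q': "q = k + n" using q by (simp add: t k_def n_def)
  \<comment> \<open>The terms free of \<open>k\<close> on the left form the square of \<open>y e - x gap t\<close>, which is \<open>z p\<close> up to a multiple of \<open>k\<close>.\<close>
  have lin: "y * e - x * gap t = z * p - k * v"
    unfolding e d p[symmetric] k_def t by (simp add: algebra_simps power2_eq_square)
  have quad: "k * v\<^sup>2 - 2 * z * p * v = e\<^sup>2 - z * e * gap t + (gap t)\<^sup>2 - z\<^sup>2 * n"
    unfolding e d n_def p[symmetric] k_def t by (simp add: algebra_simps power2_eq_square)
  have "(y * e - x * gap t)\<^sup>2 = z\<^sup>2 * p\<^sup>2 + k * (e\<^sup>2 - z * e * gap t + (gap t)\<^sup>2 - z\<^sup>2 * n)"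
    unfolding lin quad[symmetric] by (simp add: algebra_simps power2_eq_square)
  moreover have "e\<^sup>2 * (y\<^sup>2 - k) + e * gap t * (z * k - 2 * x * y) + (gap t)\<^sup>2 * (x\<^sup>2 - k) =
      (y * e - x * gap t)\<^sup>2 - k * (e\<^sup>2 - z * e * gap t + (gap t)\<^sup>2)"
    by (simp add: algebra_simps power2_eq_square)
  moreover have "z\<^sup>2 * twist_norm p q k = z\<^sup>2 * p\<^sup>2 - k * (z\<^sup>2 * n)"
    unfolding q' twist_norm_def by (simp add: algebra_simps power2_eq_square)
  ultimately show ?thesis by (simp add: algebra_simps)
qed

lemma last_coordinates:
  assumes t: "t = (x, y, z, u, v, w)" and p: "pfaffian t = p"
  shows "(markov t - y\<^sup>2) * v = x * gap t + z * (p - y * u)"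
    and "(markov t - y\<^sup>2) * w = (x * y - z) * gap t + x * (p - y * u)"
  unfolding p[symmetric] t by (simp_all add: algebra_simps power2_eq_square)

text \<open>A bi-infinite sequence with trace \<open>m\<close> is of hyperbolic sine type if \<open>r > 0\<close> and of hyperbolic cosine
  type if \<open>r < 0\<close>; the two bounds are those for the term of least absolute value in either case.\<close>

lemma twist_minimal:
  fixes d a b m r :: int
  assumes "a + b = m * d" and "a * b = d\<^sup>2 - r" and "\<bar>d\<bar> \<le> \<bar>a\<bar>" and "\<bar>d\<bar> \<le> \<bar>b\<bar>"
  shows "r > 0 \<Longrightarrow> d\<^sup>2 \<le> r" and "r \<le> 0 \<Longrightarrow> (\<bar>m\<bar> - 2) * d\<^sup>2 \<le> - r"
proof -
  have ab: "d\<^sup>2 \<le> \<bar>a * b\<bar>"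
    using mult_mono[OF assms(3,4)] by (simp add: abs_mult power2_eq_square)
  show "d\<^sup>2 \<le> r" if "r > 0" using ab assms(2) that by linarith
  show "(\<bar>m\<bar> - 2) * d\<^sup>2 \<le> - r" if "r \<le> 0"
  proof -
    have "a * b \<ge> 0" using assms(2) that zero_le_power2[of d] by linarith
    then have "\<bar>a + b\<bar> = \<bar>a\<bar> + \<bar>b\<bar>" by (auto simp: zero_le_mult_iff)
    then have s: "\<bar>a\<bar> + \<bar>b\<bar> = \<bar>m\<bar> * \<bar>d\<bar>" using assms(1) by (simp add: abs_mult)
    \<comment> \<open>The neighbours have equal signs, so the sum of their absolute values is known as well as their product.\<close>
    have "0 \<le> (\<bar>a\<bar> - \<bar>d\<bar>) * (\<bar>b\<bar> - \<bar>d\<bar>)" using assms by simp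
    also have "\<dots> = \<bar>a * b\<bar> - (\<bar>a\<bar> + \<bar>b\<bar>) * \<bar>d\<bar> + \<bar>d\<bar>\<^sup>2"
      by (simp add: abs_mult algebra_simps power2_eq_square)
    also have "\<dots> = d\<^sup>2 - r - \<bar>m\<bar> * d\<^sup>2 + d\<^sup>2"
      using \<open>a * b \<ge> 0\<close> assms(2) unfolding s by (simp add: power2_eq_square mult.assoc)
    finally show ?thesis by (simp add: algebra_simps)
  qed
qed

section \<open>Size estimates\<close>

lemma abs_le_of_sq: "x\<^sup>2 \<le> b\<^sup>2 \<Longrightarrow> 0 \<le> b \<Longrightarrow> \<bar>x\<bar> \<le> (b::int)"
  using abs_le_square_iff[of x b] by simp

text \<open>The hypotheses hold for a state of least \<open>|K|\<close> with \<open>K > 0\<close> and minimal gap \<open>d\<close>. When \<open>|y|\<close> is large, the bound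
  on \<open>d\<close> contradicts \<open>|K| \<le> |L|\<close>. The margin is thin: \<open>d\<^sup>2\<close> stays below \<open>K\<^sup>2\<close> by about \<open>y\<^sup>2 K / 2\<close>, while the other terms of \<open>K L\<close>
  are of order \<open>|y| K\<close>. The threshold is what makes the former exceed the latter.\<close>

lemma descent_positive:
  fixes k n y d h p q l :: int
  assumes n: "n = \<bar>y\<bar>" and nk: "n\<^sup>2 \<le> k"
    and d: "twist_norm p q k \<ge> 0 \<Longrightarrow> (k - 4) * d\<^sup>2 \<le> (k - n\<^sup>2) * twist_norm p q k"
    and h: "(k * h - 2 * p * y)\<^sup>2 = k * (k - 4) * d\<^sup>2 + 4 * (y\<^sup>2 - k) * twist_norm p q k"
    and l: "k * l = d\<^sup>2 - p * y * h + p\<^sup>2 + q * y\<^sup>2"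
    and kl: "k \<le> \<bar>l\<bar>"
  shows "n < 4 * \<bar>q\<bar> + 8 * p\<^sup>2 + 4 * \<bar>p\<bar> + 5"
proof (rule ccontr)
  define c where "c = 4 * \<bar>q\<bar> + 8 * p\<^sup>2 + 4 * \<bar>p\<bar> + 5"
  define s where "s = twist_norm p q k"
  assume "\<not> ?thesis"
  then have nc: "n \<ge> c" by (simp add: c_def)
  have p2: "\<bar>p\<bar> \<le> p\<^sup>2" "0 \<le> p\<^sup>2"
    using self_le_power[of "\<bar>p\<bar>" 2] by (cases "p = 0"; simp)+
  have n5: "n \<ge> 5" "n \<ge> 4 * \<bar>q\<bar>" "n \<ge> 8 * p\<^sup>2" using nc p2 by (simp_all add: c_def)
  have nn: "c * n \<le> n\<^sup>2" "5 * n \<le> n\<^sup>2" using nc n5 by (simp_all add: power2_eq_square mult_right_mono)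
  have y2: "y\<^sup>2 = n\<^sup>2" by (simp add: n)
  have k: "n \<le> k" "25 \<le> k" using nk nn n5 by linarith+
  have k2: "4 * \<bar>q\<bar> * k \<le> k\<^sup>2" "n * k \<le> k\<^sup>2" "8 * p\<^sup>2 \<le> k\<^sup>2"
  proof -
    show "4 * \<bar>q\<bar> * k \<le> k\<^sup>2" "n * k \<le> k\<^sup>2"
      using k n5 by (simp_all add: power2_eq_square mult_right_mono)
    have "k * 1 \<le> k * k" using k by (intro mult_left_mono) auto
    then show "8 * p\<^sup>2 \<le> k\<^sup>2" using n5 k unfolding power2_eq_square by linarith
  qed
  have qk: "\<bar>q * k\<bar> = \<bar>q\<bar> * k" using k by (simp add: abs_mult)
  have k2': "4 * (\<bar>q\<bar> * k) \<le> k\<^sup>2" using k2(1) by simp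
  have ql: "q * k \<le> \<bar>q\<bar> * k" "- (\<bar>q\<bar> * k) \<le> q * k" using qk by linarith+
  have sk: "s = k\<^sup>2 - q * k + p\<^sup>2" by (simp add: s_def twist_norm_def)
  have s: "k\<^sup>2 \<le> 2 * s" "s \<le> k\<^sup>2 + \<bar>q\<bar> * k + p\<^sup>2" "s \<le> 2 * k\<^sup>2" "s \<ge> 0"
  proof -
    show "k\<^sup>2 \<le> 2 * s" using sk ql k2' p2(2) zero_le_power2[of k] by linarith
    then show "s \<ge> 0" using zero_le_power2[of k] by linarith
    show "s \<le> k\<^sup>2 + \<bar>q\<bar> * k + p\<^sup>2" using sk ql by linarith
    then show "s \<le> 2 * k\<^sup>2" using k2' k2(3) zero_le_power2[of k] by linarith
  qed
  \<comment> \<open>The gain over \<open>d\<^sup>2 \<le> s\<close> comes from the factor \<open>(k - n\<^sup>2) / (k - 4) = 1 - (n\<^sup>2 - 4) / (k - 4)\<close>.\<close>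
  have d1: "2 * d\<^sup>2 \<le> 2 * s - (n\<^sup>2 - 4) * k"
  proof -
    have "(n\<^sup>2 - 4) * (k * (k - 4)) \<le> (n\<^sup>2 - 4) * (2 * s)"
    proof (rule mult_left_mono)
      have "k * (k - 4) \<le> k\<^sup>2" using k by (simp add: power2_eq_square algebra_simps)
      then show "k * (k - 4) \<le> 2 * s" using s by linarith
    qed (use nn n5 in linarith)
    then have "(k - 4) * (2 * d\<^sup>2) \<le> (k - 4) * (2 * s - (n\<^sup>2 - 4) * k)"
      using d s(4) unfolding s_def[symmetric] by (simp add: algebra_simps)
    then show ?thesis using k by simp
  qed
  have d2: "d\<^sup>2 \<le> s"
  proof -
    have "0 \<le> (n\<^sup>2 - 4) * k" using nn n5 k by simp
    then show ?thesis using d1 by linarith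
  qed
  have hb: "\<bar>h\<bar> \<le> 2 * k + 2 * \<bar>p\<bar>"
  proof -
    have "(y\<^sup>2 - k) * s \<le> 0" using s nk y2 by (simp add: mult_nonpos_nonneg)
    then have "(k * h - 2 * p * y)\<^sup>2 \<le> k * (k - 4) * d\<^sup>2"
      using h unfolding s_def[symmetric] mult.assoc[of 4] by linarith
    also have "\<dots> \<le> k * k * (2 * k\<^sup>2)" using k s d2 by (intro mult_mono) auto
    also have "\<dots> \<le> (2 * k\<^sup>2)\<^sup>2" using k by (simp add: power2_eq_square)
    finally have "\<bar>k * h - 2 * p * y\<bar> \<le> 2 * k\<^sup>2" by (rule abs_le_of_sq) simp
    moreover have "\<bar>2 * p * y\<bar> \<le> 2 * \<bar>p\<bar> * k"
      using k n by (simp add: abs_mult mult_left_mono)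
    ultimately have "\<bar>k * h\<bar> \<le> 2 * k\<^sup>2 + 2 * \<bar>p\<bar> * k" by linarith
    then have "k * \<bar>h\<bar> \<le> k * (2 * k + 2 * \<bar>p\<bar>)"
      using k by (simp add: abs_mult power2_eq_square algebra_simps)
    then show ?thesis using k by simp
  qed
  have pyh: "\<bar>p * y * h\<bar> \<le> k * (2 * \<bar>p\<bar> * n + 2 * p\<^sup>2)"
  proof -
    have "\<bar>p * y * h\<bar> \<le> \<bar>p\<bar> * n * (2 * k + 2 * \<bar>p\<bar>)"
      using hb n by (simp add: abs_mult mult_left_mono)
    also have "\<dots> = 2 * \<bar>p\<bar> * n * k + 2 * p\<^sup>2 * n"
      by (simp add: algebra_simps power2_eq_square)
    also have "2 * p\<^sup>2 * n \<le> 2 * p\<^sup>2 * k" using k by (intro mult_left_mono) auto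
    finally show ?thesis by (simp add: algebra_simps)
  qed
  have qy: "\<bar>q * y\<^sup>2\<bar> \<le> k * \<bar>q\<bar>"
    using mult_right_mono[OF nk, of "\<bar>q\<bar>"] y2 by (simp add: abs_mult mult.commute)
  have pk: "2 * p\<^sup>2 \<le> k * (2 * p\<^sup>2)"
    using k mult_right_mono[of 1 k "2 * p\<^sup>2"] by simp
  \<comment> \<open>Multiplied by \<open>k\<close>, the left side bounds twice the sum of the error terms of \<open>k l\<close>.\<close>
  have main: "2 * (2 * \<bar>q\<bar> + 4 * p\<^sup>2 + 2 * \<bar>p\<bar> * n) < n\<^sup>2 - 4"
  proof -
    define a b where "a = \<bar>q\<bar>" and "b = \<bar>p\<bar>"
    have "c * n = 4 * (a * n) + 8 * (p\<^sup>2 * n) + 4 * (b * n) + 5 * n"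
      by (simp add: c_def a_def b_def algebra_simps)
    moreover have "a * 1 \<le> a * n" "p\<^sup>2 * 1 \<le> p\<^sup>2 * n"
      using n5 by (intro mult_left_mono; simp add: a_def)+
    ultimately have "4 * a + 8 * p\<^sup>2 + 4 * (b * n) + 4 < n\<^sup>2" using nn(1) n5(1) by linarith
    then show ?thesis by (simp add: a_def b_def)
  qed
  have km: "k * (2 * (2 * \<bar>q\<bar> + 4 * p\<^sup>2 + 2 * \<bar>p\<bar> * n)) < k * (n\<^sup>2 - 4)"
    using main k by simp
  \<comment> \<open>It remains to bound \<open>k l\<close> from both sides by \<open>k\<^sup>2\<close> in absolute value.\<close>
  have "2 * (k * l) \<le> 2 * d\<^sup>2 + 2 * \<bar>p * y * h\<bar> + 2 * p\<^sup>2 + 2 * \<bar>q * y\<^sup>2\<bar>"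
    using l by linarith
  also have "\<dots> < 2 * k\<^sup>2"
    using d1 s pyh qy pk km by (simp add: algebra_simps)
  finally have u: "k * l < k\<^sup>2" by simp
  have "- (k * l) \<le> \<bar>p * y * h\<bar> + \<bar>q * y\<^sup>2\<bar>"
    using l p2 zero_le_power2[of d] by linarith
  also have "\<dots> \<le> k * (2 * \<bar>p\<bar> * n + 2 * p\<^sup>2 + \<bar>q\<bar>)" using pyh qy by (simp add: algebra_simps)
  also have "\<dots> < k * k" 
    using main nk k p2 by (intro mult_strict_left_mono) auto
  finally have "\<bar>k * l\<bar> < k * k" using u by (simp add: power2_eq_square)
  then have "\<bar>l\<bar> < k" using k by (simp add: abs_mult)
  then show False using kl by simp
qed

text \<open>The counterpart for \<open>K = -k < 0\<close>. The products \<open>y\<close> and \<open>m\<close> are at most \<open>3 k / n\<close>, so that \<open>d\<^sup>2\<close> and every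
  other term of \<open>K L\<close> is of order \<open>k\<^sup>2 / n\<close>; the threshold for \<open>n\<close> is the sum of the implied
  constants.\<close>

lemma descent_negative:
  fixes k n y d h p q l m :: int
  assumes k0: "k > 0" and m: "n * m \<le> 3 * k" and y: "n * \<bar>y\<bar> \<le> 3 * k" and n3: "3 * n \<le> 3 * k"
    and d: "d\<^sup>2 * k \<le> m * twist_norm p q (- k)"
    and h: "(- k * h - 2 * p * y)\<^sup>2 = - k * (- k - 4) * d\<^sup>2 + 4 * (y\<^sup>2 + k) * twist_norm p q (- k)"
    and l: "- k * l = d\<^sup>2 - p * y * h + p\<^sup>2 + q * y\<^sup>2"
    and kl: "k \<le> \<bar>l\<bar>"
  shows "n < 8 + 21 * \<bar>p\<bar> + 3 * \<bar>q\<bar> + p\<^sup>2"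
proof (rule ccontr)
  define s where "s = twist_norm p q (- k)"
  assume "\<not> ?thesis"
  then have nc: "n \<ge> 8 + 21 * \<bar>p\<bar> + 3 * \<bar>q\<bar> + p\<^sup>2" by simp
  have p2: "\<bar>p\<bar> \<le> p\<^sup>2" "0 \<le> p\<^sup>2"
    using self_le_power[of "\<bar>p\<bar>" 2] by (cases "p = 0"; simp)+
  have n: "n \<ge> 8" "n \<ge> \<bar>q\<bar> + p\<^sup>2" "n \<ge> p\<^sup>2" "n \<ge> \<bar>p\<bar>" "n \<le> k" using nc p2 n3 by linarith+
  have kk: "8 * k \<le> k\<^sup>2" using n by (simp add: power2_eq_square mult_right_mono)
  have s: "s \<le> 2 * k\<^sup>2" "s \<ge> 0"
  proof -
    have "(\<bar>q\<bar> + p\<^sup>2) * k \<le> k * k" using n k0 by (intro mult_right_mono) auto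
    moreover have "p\<^sup>2 * 1 \<le> p\<^sup>2 * k" using k0 by (intro mult_left_mono) auto
    moreover have "\<bar>q * k\<bar> = \<bar>q\<bar> * k" using k0 by (simp add: abs_mult)
    ultimately show "s \<le> 2 * k\<^sup>2" "s \<ge> 0"
      unfolding s_def twist_norm_def power2_eq_square[of k] power2_eq_square[of "-k"]
      using p2 by (simp_all add: algebra_simps)
  qed
  have nd: "n * d\<^sup>2 \<le> 6 * k\<^sup>2"
  proof -
    have "(n * d\<^sup>2) * k \<le> n * (m * s)"
      using mult_left_mono[OF d, of n] n unfolding s_def by (simp add: mult.assoc)
    also have "\<dots> \<le> 3 * k * s" using mult_right_mono[OF m s(2)] by (simp add: mult.assoc)
    finally have "n * d\<^sup>2 \<le> 3 * s" using k0 by (simp add: mult.commute mult.left_commute)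
    then show ?thesis using s by linarith
  qed
  have yk: "\<bar>y\<bar> \<le> k"
  proof -
    have "3 * \<bar>y\<bar> \<le> n * \<bar>y\<bar>" using n by (intro mult_right_mono) auto
    then show ?thesis using y by linarith
  qed
  have y2: "y\<^sup>2 \<le> k\<^sup>2" using power_mono[OF yk, of 2] by simp
  have dk: "d\<^sup>2 \<le> k\<^sup>2"
  proof -
    have "8 * d\<^sup>2 \<le> n * d\<^sup>2" using n by (intro mult_right_mono) auto
    then show ?thesis using nd zero_le_power2[of k] by linarith
  qed
  have hb: "\<bar>h\<bar> \<le> 7 * k"
  proof -
    have "k * (k + 4) * d\<^sup>2 \<le> (k * (2 * k)) * k\<^sup>2" using n k0 dk by (intro mult_mono) auto
    moreover have "(y\<^sup>2 + k) * s \<le> (2 * k\<^sup>2) * (2 * k\<^sup>2)"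
      using y2 kk s k0 by (intro mult_mono) auto
    ultimately have "(k * h + 2 * p * y)\<^sup>2 \<le> 18 * (k\<^sup>2 * k\<^sup>2)"
      using h unfolding s_def[symmetric] by (simp add: power2_eq_square algebra_simps)
    also have "\<dots> \<le> 25 * (k\<^sup>2 * k\<^sup>2)" by (intro mult_right_mono) auto
    also have "\<dots> = (5 * k\<^sup>2)\<^sup>2" by (simp add: power2_eq_square)
    finally have "\<bar>k * h + 2 * p * y\<bar> \<le> 5 * k\<^sup>2" by (rule abs_le_of_sq) simp
    moreover have "\<bar>2 * p * y\<bar> \<le> 2 * (k * k)"
      using mult_mono[of "\<bar>p\<bar>" k "\<bar>y\<bar>" k] yk n k0 by (simp add: abs_mult)
    ultimately have "\<bar>k * h\<bar> \<le> 7 * k\<^sup>2" unfolding power2_eq_square by linarith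
    then have "k * \<bar>h\<bar> \<le> k * (7 * k)" using k0 by (simp add: abs_mult power2_eq_square)
    then show ?thesis using k0 by simp
  qed
  have "n * \<bar>k * l\<bar> \<le> n * (d\<^sup>2 + \<bar>p * y * h\<bar> + p\<^sup>2 + \<bar>q * y\<^sup>2\<bar>)"
    using l p2 n zero_le_power2[of d] by (intro mult_left_mono) linarith+
  also have "\<dots> = n * d\<^sup>2 + \<bar>p\<bar> * ((n * \<bar>y\<bar>) * \<bar>h\<bar>) + n * p\<^sup>2 + \<bar>q\<bar> * ((n * \<bar>y\<bar>) * \<bar>y\<bar>)"
    by (simp add: abs_mult algebra_simps power2_eq_square)
  also have "\<dots> \<le> 6 * k\<^sup>2 + \<bar>p\<bar> * ((3 * k) * (7 * k)) + k\<^sup>2 + \<bar>q\<bar> * ((3 * k) * k)"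
  proof (intro add_mono)
    show "\<bar>p\<bar> * ((n * \<bar>y\<bar>) * \<bar>h\<bar>) \<le> \<bar>p\<bar> * ((3 * k) * (7 * k))"
      using k0 by (intro mult_left_mono mult_mono[OF y hb]) auto
    show "\<bar>q\<bar> * ((n * \<bar>y\<bar>) * \<bar>y\<bar>) \<le> \<bar>q\<bar> * ((3 * k) * k)"
      using k0 by (intro mult_left_mono mult_mono[OF y yk]) auto
    show "n * p\<^sup>2 \<le> k\<^sup>2"
      unfolding power2_eq_square[of k] using n by (intro mult_mono) auto
  qed (use nd in auto)
  also have "\<dots> = (7 + 21 * \<bar>p\<bar> + 3 * \<bar>q\<bar>) * k\<^sup>2" by (simp add: algebra_simps power2_eq_square)
  also have "\<dots> < n * k\<^sup>2" using nc p2 k0 by (intro mult_strict_right_mono) auto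
  finally have "\<bar>k * l\<bar> < k\<^sup>2" using n by simp
  then have "\<bar>l\<bar> < k" using k0 by (simp add: abs_mult power2_eq_square)
  then show False using kl by simp
qed

text \<open>Markov reduction: if no Vieta move shortens a positive triple, then the triple is \<open>(2, n, n)\<close>, of Markov
  invariant 4, or all entries are at least 3. In the second case, apart from triples with middle entry 3, the Markov
  invariant is negative, and its absolute value is at least a third of the product of the two larger entries. For fixed \<open>x\<close> and \<open>y\<close> the estimate is concave in \<open>z\<close>, hence it follows from the end points
  \<open>z = y\<close> and \<open>z = x y / 2\<close>.\<close>

lemma markov_sorted:
  fixes x y z :: int
  assumes "1 \<le> x" "x \<le> y" "y \<le> z" "2 * z \<le> x * y"
  shows "x = 2 \<and> y = z \<or> 3 \<le> x \<and> z \<le> y\<^sup>2 \<and>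
    (4 \<le> y \<longrightarrow> y * z \<le> 3 * (x * y * z - x\<^sup>2 - y\<^sup>2 - z\<^sup>2))"
proof -
  have "2 * y \<le> x * y" using assms by linarith
  then have x2: "2 \<le> x" using assms by simp
  show ?thesis
  proof (cases "x = 2")
    case True
    then show ?thesis using assms by simp
  next
    case False
    then have x3: "3 \<le> x" using x2 by simp
    have "x * y \<le> y * y" using assms by (intro mult_right_mono) auto
    then have z: "z \<le> y\<^sup>2" using assms unfolding power2_eq_square by linarith
    have "y * z \<le> 3 * (x * y * z - x\<^sup>2 - y\<^sup>2 - z\<^sup>2)" if "4 \<le> y"
    proof -
      have 1: "0 \<le> (z - y) * (x * y - 2 * z)" using assms by simp
      have 2: "0 \<le> (3 * x - 8) * y * (z - y)" using assms x3 by simp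
      have 3: "3 * x\<^sup>2 \<le> (3 * x - 7) * y\<^sup>2"
      proof (cases "x = 3")
        case True
        have "4 * 4 \<le> y * y" using that by (intro mult_mono) auto
        then show ?thesis using True by (simp add: power2_eq_square)
      next
        case False
        have "3 * x\<^sup>2 \<le> 3 * y\<^sup>2" using power_mono[of x y 2] assms by simp
        also have "\<dots> \<le> (3 * x - 7) * y\<^sup>2" using False x3 by (intro mult_right_mono) auto
        finally show ?thesis .
      qed
      have *: "2 * (3 * (x * y * z - x\<^sup>2 - y\<^sup>2 - z\<^sup>2) - y * z) =
        3 * ((z - y) * (x * y - 2 * z)) + (3 * x - 8) * y * (z - y) + 2 * ((3 * x - 7) * y\<^sup>2 - 3 * x\<^sup>2)"
        by (simp add: algebra_simps power2_eq_square)
      have "0 \<le> 2 * (3 * (x * y * z - x\<^sup>2 - y\<^sup>2 - z\<^sup>2) - y * z)"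
        unfolding * using 1 2 3 by simp
      then show ?thesis by simp
    qed
    then show ?thesis using x3 z by simp
  qed
qed

text \<open>The preceding lemma freed from the order of the entries; \<open>n\<close> is the middle one.\<close>

lemma markov_positive:
  fixes x y z :: int
  defines "k \<equiv> x * y * z - x\<^sup>2 - y\<^sup>2 - z\<^sup>2"
  assumes "1 \<le> x" "1 \<le> y" "1 \<le> z" "2 * x \<le> y * z" "2 * y \<le> x * z" "2 * z \<le> x * y"
  shows "x = 2 \<and> y = z \<or> y = 2 \<and> x = z \<or> z = 2 \<and> x = y \<or>
    (\<exists>n. 3 \<le> x \<and> 3 \<le> y \<and> 3 \<le> z \<and> x \<le> n\<^sup>2 \<and> y \<le> n\<^sup>2 \<and> z \<le> n\<^sup>2 \<and>
      3 \<le> n \<and> (4 \<le> n \<longrightarrow> n * x \<le> 3 * k \<and> n * y \<le> 3 * k \<and> n * z \<le> 3 * k))"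
proof -
  have sorted: "a = 2 \<and> b = c \<or> (\<exists>n. 3 \<le> a \<and> 3 \<le> b \<and> 3 \<le> c \<and> a \<le> n\<^sup>2 \<and> b \<le> n\<^sup>2 \<and> c \<le> n\<^sup>2 \<and>
      3 \<le> n \<and> (4 \<le> n \<longrightarrow> n * a \<le> 3 * l \<and> n * b \<le> 3 * l \<and> n * c \<le> 3 * l))"
    if "1 \<le> a" "a \<le> b" "b \<le> c" "2 * c \<le> a * b" "a * b * c - a\<^sup>2 - b\<^sup>2 - c\<^sup>2 = l" for a b c l :: int
  proof (cases "a = 2 \<and> b = c")
    case False
    then have m: "3 \<le> a" "c \<le> b\<^sup>2" "4 \<le> b \<Longrightarrow> b * c \<le> 3 * l"
      using markov_sorted[OF that(1-4)] that(5) by auto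
    have "b * a \<le> b * c" "b * b \<le> b * c" using that by (auto intro: mult_left_mono)
    then have "4 \<le> b \<longrightarrow> b * a \<le> 3 * l \<and> b * b \<le> 3 * l \<and> b * c \<le> 3 * l"
      using m(3) by linarith
    moreover have "b \<le> b\<^sup>2" using that by (simp add: power2_eq_square)
    ultimately show ?thesis using m(1,2) that(1-4) by (intro disjI2 exI[of _ b]) auto
  qed simp
  consider "x \<le> y" "y \<le> z" | "x \<le> z" "z \<le> y" | "y \<le> x" "x \<le> z" | "y \<le> z" "z \<le> x"
    | "z \<le> x" "x \<le> y" | "z \<le> y" "y \<le> x" by linarith
  then show ?thesis
  proof cases
    case 1 then show ?thesis using sorted[of x y z k] assms by (auto simp: algebra_simps)
  next
    case 2 then show ?thesis using sorted[of x z y k] assms by (auto simp: algebra_simps)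
  next
    case 3 then show ?thesis using sorted[of y x z k] assms by (auto simp: algebra_simps)
  next
    case 4 then show ?thesis using sorted[of y z x k] assms by (auto simp: algebra_simps)
  next
    case 5 then show ?thesis using sorted[of z x y k] assms by (auto simp: algebra_simps)
  next
    case 6 then show ?thesis using sorted[of z y x k] assms by (auto simp: algebra_simps)
  qed
qed

section \<open>Descent inside one orbit\<close>

text \<open>The thresholds of the two descent estimates, for triples with \<open>x y z \<le> 0\<close> and \<open>x y z > 0\<close>.\<close>

definition bound_nonpos :: "int \<Rightarrow> int \<Rightarrow> int" where
  "bound_nonpos p q = 4 * \<bar>q\<bar> + 8 * p\<^sup>2 + 4 * \<bar>p\<bar> + 5"

definition bound_pos :: "int \<Rightarrow> int \<Rightarrow> int" where
  "bound_pos p q = 8 + 21 * \<bar>p\<bar> + 3 * \<bar>q\<bar> + p\<^sup>2"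

lemma vieta_minimal:
  fixes x y z :: int
  assumes "\<bar>z\<bar> \<le> \<bar>x * y - z\<bar>" and "x * y * z > 0"
  shows "2 * \<bar>z\<bar> \<le> \<bar>x\<bar> * \<bar>y\<bar>"
proof -
  have xy: "\<bar>x\<bar> * \<bar>y\<bar> = \<bar>x * y\<bar>" by (simp add: abs_mult)
  have "z > 0 \<and> x * y > 0 \<or> z < 0 \<and> x * y < 0"
    using assms(2) by (auto simp: zero_less_mult_iff mult_less_0_iff)
  then show ?thesis using assms(1) unfolding xy by linarith
qed

text \<open>The set \<open>Q\<close> plays the role of the integral points of one braid orbit. The closure conditions are the braids
  that the descent uses; the state of \<open>drop_closed\<close> has first three vectors \<open>e\<^sub>2, e\<^sub>3, e\<^sub>4\<close>.\<close>

locale closed_states =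
  fixes Q :: "state set" and p q :: int
  assumes nonempty: "Q \<noteq> {}"
    and rot_closed: "t \<in> Q \<Longrightarrow> rot t \<in> Q"
    and rotinv_closed: "t \<in> Q \<Longrightarrow> rotinv t \<in> Q"
    and vieta_closed: "t \<in> Q \<Longrightarrow> vieta t \<in> Q"
    and drop_closed: "(x, y, z, u, v, w) \<in> Q \<Longrightarrow> \<exists>u' v' w'. (y, w, y * w - v, u', v', w') \<in> Q"
    and pf: "t \<in> Q \<Longrightarrow> pfaffian t = p"
    and ct: "t \<in> Q \<Longrightarrow> cotrace t = q"
    and p_nonzero: "p \<noteq> 0"
    and twist_norm_4: "twist_norm p q 4 \<noteq> 0"
begin

text \<open>Least \<open>|K|\<close> in the orbit, and least \<open>|x| + |y| + |z|\<close> among those. Both measures are invariant under rotation, so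
  the position of \<open>e\<^sub>4\<close> can still be normalised afterwards.\<close>

definition reduced :: "state \<Rightarrow> bool" where
  "reduced t \<longleftrightarrow> t \<in> Q \<and> (\<forall>t'\<in>Q. \<bar>markov t\<bar> \<le> \<bar>markov t'\<bar> \<and>
     (\<bar>markov t'\<bar> = \<bar>markov t\<bar> \<longrightarrow> size3 t \<le> size3 t'))"

lemma reducedD: "reduced t \<Longrightarrow> t \<in> Q" by (simp add: reduced_def)

lemma reduced_exists: "\<exists>t. reduced t"
proof -
  obtain s where s: "s \<in> Q" "\<And>t. t \<in> Q \<Longrightarrow> nat \<bar>markov s\<bar> \<le> nat \<bar>markov t\<bar>"
    using nonempty ex_has_least_nat[of "\<lambda>t. t \<in> Q" _ "\<lambda>t. nat \<bar>markov t\<bar>"] by blast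
  obtain r where r: "r \<in> Q \<and> \<bar>markov r\<bar> = \<bar>markov s\<bar>"
      "\<And>t. t \<in> Q \<and> \<bar>markov t\<bar> = \<bar>markov s\<bar> \<Longrightarrow> nat (size3 r) \<le> nat (size3 t)"
    using s(1) ex_has_least_nat[of "\<lambda>t. t \<in> Q \<and> \<bar>markov t\<bar> = \<bar>markov s\<bar>" s "\<lambda>t. nat (size3 t)"]
    by blast
  have pos: "0 \<le> size3 t" for t by (cases t) simp
  have "reduced r"
    unfolding reduced_def
  proof (intro conjI ballI impI)
    fix t assume t: "t \<in> Q"
    show "\<bar>markov r\<bar> \<le> \<bar>markov t\<bar>" using s(2)[OF t] r(1) by simp
    assume "\<bar>markov t\<bar> = \<bar>markov r\<bar>"
    then show "size3 r \<le> size3 t" using r(2)[of t] r(1) t pos[of t] pos[of r] by simp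
  qed (use r in simp)
  then show ?thesis ..
qed

lemma reduced_rot: "reduced t \<Longrightarrow> reduced (rot t)" "reduced t \<Longrightarrow> reduced (rotinv t)"
  by (simp_all add: reduced_def rot_closed rotinv_closed)

lemma reduced_vieta:
  assumes "reduced (x, y, z, u, v, w)"
  shows "\<bar>z\<bar> \<le> \<bar>x * y - z\<bar>" "\<bar>x\<bar> \<le> \<bar>y * z - x\<bar>" "\<bar>y\<bar> \<le> \<bar>x * z - y\<bar>"
proof -
  have *: "\<bar>c\<bar> \<le> \<bar>a * b - c\<bar>" if "reduced (a, b, c, u, v, w)" for a b c u v w
  proof -
    have "size3 (a, b, c, u, v, w) \<le> size3 (vieta (a, b, c, u, v, w))"
      using that vieta_closed[OF reducedD[OF that]] markov_vieta[of "(a, b, c, u, v, w)"]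
      unfolding reduced_def by metis
    then show ?thesis by simp
  qed
  show "\<bar>z\<bar> \<le> \<bar>x * y - z\<bar>" by (rule *[OF assms])
  have "reduced (y, z, x, v, w, u - x * v + z * w)" using reduced_rot(1)[OF assms] by simp
  then show "\<bar>x\<bar> \<le> \<bar>y * z - x\<bar>" by (rule *)
  have "reduced (z, x, y, w - y * v + z * u, u, v)" using reduced_rot(2)[OF assms] by simp
  then show "\<bar>y\<bar> \<le> \<bar>x * z - y\<bar>" using * by (metis mult.commute)
qed

lemma reduced_markov_le:
  assumes "reduced t" and t: "t = (x, y, z, u, v, w)"
  shows "\<bar>markov t\<bar> \<le> \<bar>y\<^sup>2 + v\<^sup>2 + w\<^sup>2 - y * v * w\<bar>"
proof -
  obtain u' v' w' where "(y, w, y * w - v, u', v', w') \<in> Q"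
    using drop_closed reducedD[OF assms(1)] t by blast
  then have "\<bar>markov t\<bar> \<le> \<bar>markov (y, w, y * w - v, u', v', w')\<bar>"
    using assms(1) unfolding reduced_def by blast
  also have "markov (y, w, y * w - v, u', v', w') = y\<^sup>2 + v\<^sup>2 + w\<^sup>2 - y * v * w"
    by (simp add: algebra_simps power2_eq_square)
  finally show ?thesis .
qed

lemma gap_minimal:
  assumes "A t"
  obtains s where "A s" "\<And>t. A t \<Longrightarrow> \<bar>gap s\<bar> \<le> \<bar>gap t\<bar>"
proof -
  obtain s where s: "A s" "\<And>t. A t \<Longrightarrow> nat \<bar>gap s\<bar> \<le> nat \<bar>gap t\<bar>"
    using assms ex_has_least_nat[of A t "\<lambda>t. nat \<bar>gap t\<bar>"] by blast
  show thesis
  proof (rule that[OF s(1)])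
    show "\<bar>gap s\<bar> \<le> \<bar>gap t\<bar>" if "A t" for t using s(2)[OF that] by linarith
  qed
qed

lemma twist_bound:
  assumes "t \<in> Q" and t: "t = (x, y, z, u, v, w)"
    and "\<bar>gap t\<bar> \<le> \<bar>gap (rot (rot (rot t)))\<bar>" and "\<bar>gap t\<bar> \<le> \<bar>gap (rotinv (rotinv (rotinv t)))\<bar>"
  defines "r \<equiv> (y\<^sup>2 - markov t) * twist_norm p q (markov t)"
  shows "r > 0 \<Longrightarrow> (gap t)\<^sup>2 \<le> r" and "r \<le> 0 \<Longrightarrow> (\<bar>2 - markov t\<bar> - 2) * (gap t)\<^sup>2 \<le> - r"
  using twist_minimal[OF twist_linear[OF t] gap_quadratic[OF t pf ct] assms(3,4)] assms(1)
  unfolding r_def by blast+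

text \<open>If \<open>x y z \<le> 0\<close>, then \<open>K\<close> is at least the square of each entry. The argument takes the entry of largest
  absolute value into the middle and makes the gap minimal under the twist; if \<open>twist_norm\<close> is nonnegative, as
  it is for large \<open>K\<close>, the gaps there are of hyperbolic cosine type, and \<open>descent_positive\<close> applies.\<close>

lemma bounded_nonpos:
  assumes "reduced (x, y, z, u, v, w)" and "x * y * z \<le> 0"
  shows "\<bar>x\<bar> < bound_nonpos p q \<and> \<bar>y\<bar> < bound_nonpos p q \<and> \<bar>z\<bar> < bound_nonpos p q"
proof -
  have middle: "\<bar>b\<bar> < bound_nonpos p q"
    if red: "reduced (a, b, c, u, v, w)" and abc: "a * b * c \<le> 0" "\<bar>a\<bar> \<le> \<bar>b\<bar>" "\<bar>c\<bar> \<le> \<bar>b\<bar>" for a b c u v w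
  proof -
    define A where "A = (\<lambda>t. reduced t \<and> (\<exists>u v w. t = (a, b, c, u, v, w)))"
    have "A (a, b, c, u, v, w)" using red by (auto simp: A_def)
    then obtain t where t: "A t" "\<And>s. A s \<Longrightarrow> \<bar>gap t\<bar> \<le> \<bar>gap s\<bar>"
      using gap_minimal[of A] by blast
    then obtain u v w where e: "t = (a, b, c, u, v, w)" and r: "reduced t" by (auto simp: A_def)
    have "A (rot (rot (rot t)))" "A (rotinv (rotinv (rotinv t)))"
      using e r by (auto simp: A_def reduced_rot simp del: rot.simps rotinv.simps)
        (auto simp: e)
    note tw = twist_bound[OF reducedD[OF r] e t(2)[OF this(1)] t(2)[OF this(2)]]
    define k where "k = markov t"
    have "k = a\<^sup>2 + b\<^sup>2 + c\<^sup>2 - a * b * c" by (simp add: k_def e)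
    then have k: "\<bar>b\<bar>\<^sup>2 \<le> k"
      using abc(1) zero_le_power2[of a] zero_le_power2[of c] unfolding power2_abs by linarith
    have "(k - 4) * (gap t)\<^sup>2 \<le> (k - \<bar>b\<bar>\<^sup>2) * twist_norm p q k" if "twist_norm p q k \<ge> 0"
    proof -
      have "(b\<^sup>2 - k) * twist_norm p q k \<le> 0" using k that by (simp add: mult_nonpos_nonneg)
      then have "(\<bar>2 - k\<bar> - 2) * (gap t)\<^sup>2 \<le> - ((b\<^sup>2 - k) * twist_norm p q k)"
        using tw(2) unfolding k_def by simp
      moreover have "(k - 4) * (gap t)\<^sup>2 \<le> (\<bar>2 - k\<bar> - 2) * (gap t)\<^sup>2"
        by (intro mult_right_mono) auto
      ultimately show ?thesis by (simp add: algebra_simps)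
    qed
    moreover have "k \<le> \<bar>b\<^sup>2 + v\<^sup>2 + w\<^sup>2 - b * v * w\<bar>"
      using reduced_markov_le[OF r e] unfolding k_def by linarith
    ultimately show ?thesis
      unfolding bound_nonpos_def
      using descent_positive[OF HOL.refl k _ height_equation[OF e pf ct, folded k_def]
          markov_product[OF e pf ct, folded k_def]] reducedD[OF r] by blast
  qed
  consider "\<bar>x\<bar> \<le> \<bar>y\<bar>" "\<bar>z\<bar> \<le> \<bar>y\<bar>" | "\<bar>y\<bar> \<le> \<bar>x\<bar>" "\<bar>z\<bar> \<le> \<bar>x\<bar>" | "\<bar>x\<bar> \<le> \<bar>z\<bar>" "\<bar>y\<bar> \<le> \<bar>z\<bar>"
    by linarith
  then show ?thesis
  proof cases
    case 1 then show ?thesis using middle[OF assms] by simp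
  next
    case 2 then show ?thesis
      using middle[OF reduced_rot(2)[OF assms(1), unfolded rotinv.simps]] assms(2) by (simp add: ac_simps)
  next
    case 3 then show ?thesis
      using middle[OF reduced_rot(1)[OF assms(1), unfolded rot.simps]] assms(2) by (simp add: ac_simps)
  qed
qed

text \<open>At a sign change between the gaps of adjacent states all three terms of \<open>gap_adjacent\<close> have the same sign,
  so the cross term alone bounds the smaller gap. This is stronger than the bound over a full
  period, which for \<open>K < 0\<close> only gives \<open>d\<^sup>2 \<lesssim> K\<^sup>2 + y\<^sup>2 |K|\<close> and does not contradict the minimality of \<open>|K|\<close>.\<close>

lemma adjacent_bound:
  assumes "t \<in> Q" and t: "t = (x, y, z, u, v, w)" and "x * y * z > 0" and k: "markov t = - k" "k > 0"
    and sgn: "z * (gap (rotinv t) * gap t) \<le> 0"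
    and d: "\<bar>d\<bar> \<le> \<bar>gap (rotinv t)\<bar>" "\<bar>d\<bar> \<le> \<bar>gap t\<bar>"
  shows "d\<^sup>2 * k \<le> \<bar>z\<bar> * twist_norm p q (- k)"
proof -
  define e f where "e = gap (rotinv t)" and "f = gap t"
  have z: "z \<noteq> 0" using assms(3) by auto
  have id: "e\<^sup>2 * (y\<^sup>2 + k) - e * f * (z * k + 2 * x * y) + f\<^sup>2 * (x\<^sup>2 + k) = z\<^sup>2 * twist_norm p q (- k)"
    using gap_adjacent[OF t pf ct] assms(1) k unfolding e_def f_def by (simp add: algebra_simps)
  have ef: "d\<^sup>2 \<le> \<bar>e * f\<bar>"
    using mult_mono[OF d] by (simp add: abs_mult power2_eq_square e_def f_def)
  have "\<bar>e * f\<bar> * (\<bar>z\<bar> * k) \<le> - (e * f * (z * k + 2 * x * y))"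
  proof (cases "z > 0")
    case True
    then have "x * y > 0" using assms(3) by (simp add: zero_less_mult_iff)
    moreover have "e * f \<le> 0" using sgn True by (simp add: mult_le_0_iff e_def f_def)
    moreover from calculation have "(e * f) * (x * y) \<le> 0" by (simp add: mult_nonpos_nonneg)
    ultimately show ?thesis using True by (simp add: algebra_simps abs_if)
  next
    case False
    then have "x * y < 0" using assms(3) z by (auto simp: zero_less_mult_iff mult_less_0_iff)
    moreover have "e * f \<ge> 0" using sgn False z by (auto simp: mult_le_0_iff e_def f_def)
    moreover from calculation have "(e * f) * (x * y) \<le> 0" by (simp add: mult_nonneg_nonpos)
    ultimately show ?thesis using False z by (simp add: algebra_simps abs_if)
  qed
  moreover have "0 \<le> e\<^sup>2 * (y\<^sup>2 + k)" "0 \<le> f\<^sup>2 * (x\<^sup>2 + k)" using k by simp_all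
  moreover have "d\<^sup>2 * (\<bar>z\<bar> * k) \<le> \<bar>e * f\<bar> * (\<bar>z\<bar> * k)" using ef k by (intro mult_right_mono) auto
  ultimately have "d\<^sup>2 * (\<bar>z\<bar> * k) \<le> z\<^sup>2 * twist_norm p q (- k)" using id by linarith
  then have "\<bar>z\<bar> * (d\<^sup>2 * k) \<le> \<bar>z\<bar> * (\<bar>z\<bar> * twist_norm p q (- k))"
    by (simp add: algebra_simps power2_eq_square)
  then show ?thesis using z by simp
qed

text \<open>Reduced states with \<open>x y z > 0\<close> for which the products are at most \<open>3 |K| / n\<close>. The conditions are
  symmetric in \<open>x, y, z\<close> in order to survive rotation.\<close>

definition steep :: "int \<Rightarrow> state \<Rightarrow> bool" where
  "steep n t \<longleftrightarrow> reduced t \<and> (case t of (x, y, z, u, v, w) \<Rightarrow> x * y * z > 0 \<and>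
     3 \<le> \<bar>x\<bar> \<and> 3 \<le> \<bar>y\<bar> \<and> 3 \<le> \<bar>z\<bar> \<and>
     n * \<bar>x\<bar> \<le> - 3 * markov t \<and> n * \<bar>y\<bar> \<le> - 3 * markov t \<and> n * \<bar>z\<bar> \<le> - 3 * markov t)"

lemma steep_rot: "steep n t \<Longrightarrow> steep n (rot t)" "steep n t \<Longrightarrow> steep n (rotinv t)"
  unfolding steep_def markov_rot using reduced_rot[of t]
  by (cases t; simp add: ac_simps)+

text \<open>Here \<open>K < 0\<close>, and the gaps over full periods are of hyperbolic sine type: the sequence changes sign. Hence
  some pair of adjacent states changes sign as well, and the least gap among all steep states is
  controlled by \<open>adjacent_bound\<close>.\<close>

lemma steep_bound:
  assumes "steep n t" and "n > 0"
  shows "n < bound_pos p q"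
proof (rule ccontr)
  assume "\<not> ?thesis"
  then have n: "n \<ge> bound_pos p q" by simp
  obtain t where t: "steep n t" "\<And>s. steep n s \<Longrightarrow> \<bar>gap t\<bar> \<le> \<bar>gap s\<bar>"
    using gap_minimal[of "steep n"] assms(1) by blast
  define k where "k = - markov t"
  obtain x y z u v w where e: "t = (x, y, z, u, v, w)" by (cases t)
  have r: "reduced t" and Q: "t \<in> Q" using t(1) reducedD by (auto simp: steep_def)
  have x: "n * \<bar>x\<bar> \<le> 3 * k" "n * \<bar>y\<bar> \<le> 3 * k" "3 \<le> \<bar>x\<bar>"
    using t(1) by (auto simp: steep_def e k_def)
  have nk: "3 * n \<le> 3 * k"
    using mult_left_mono[OF x(3), of n] x(1) assms(2) by linarith
  have k0: "k > 0" using nk assms(2) by simp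
  have S: "twist_norm p q (- k) > 0"
  proof -
    have "\<bar>q\<bar> < k" using n nk unfolding bound_pos_def using zero_le_power2[of p] by linarith
    then have "\<bar>q\<bar> * k < k * k" using k0 by simp
    moreover have "\<bar>q * k\<bar> = \<bar>q\<bar> * k" using k0 by (simp add: abs_mult)
    ultimately have "0 < k * k + q * k" by linarith
    moreover have "twist_norm p q (- k) = k * k + q * k + p * p"
      by (simp add: twist_norm_def power2_eq_square)
    ultimately show ?thesis using zero_le_square[of p] by linarith
  qed
  define a b where "a = gap (rot (rot (rot t)))" and "b = gap (rotinv (rotinv (rotinv t)))"
  have ab: "\<bar>gap t\<bar> \<le> \<bar>a\<bar>" "\<bar>gap t\<bar> \<le> \<bar>b\<bar>"
    using t steep_rot unfolding a_def b_def by meson+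
  have "a * b = (gap t)\<^sup>2 - (y\<^sup>2 + k) * twist_norm p q (- k)"
    using gap_quadratic[OF e pf[OF Q] ct[OF Q]] by (simp add: a_def b_def k_def)
  moreover have "(y\<^sup>2 + k) * twist_norm p q (- k) > 0"
    using S k0 zero_le_power2[of y] by (intro mult_pos_pos) linarith+
  ultimately have ab': "a * b < (gap t)\<^sup>2" by linarith
  \<comment> \<open>Otherwise \<open>a\<close>, \<open>b\<close> and the gap of \<open>t\<close> have one sign, and \<open>a b\<close> is at least the square of the least gap.\<close>
  have "gap t * a \<le> 0 \<or> b * gap t \<le> 0"
  proof (rule ccontr)
    assume "\<not> ?thesis"
    then have "a * b > 0" by (auto simp: zero_less_mult_iff not_le)
    then have "a * b = \<bar>a\<bar> * \<bar>b\<bar>" by (simp add: abs_mult[symmetric])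
    moreover have "(gap t)\<^sup>2 \<le> \<bar>a\<bar> * \<bar>b\<bar>"
      using mult_mono[OF ab] by (simp add: power2_eq_square abs_mult[symmetric])
    ultimately show False using ab' by simp
  qed
  moreover have "rot (rot (rot (rotinv (rotinv (rotinv t))))) = t" by simp
  ultimately obtain s where s: "steep n s" "gap s * gap (rot (rot (rot s))) \<le> 0" "markov s = - k"
    using t(1) steep_rot unfolding a_def b_def k_def
    by (metis markov_rot minus_minus)
  obtain x' y' z' u' v' w' where e': "s = (x', y', z', u', v', w')" by (cases s)
  have pos: "x' * y' * z' > 0" using s(1) by (simp add: steep_def e')
  \<comment> \<open>Three adjacent pairs lead from \<open>s\<close> to its twist. If each product had the sign of the corresponding
    entry, then multiplying them would make the signs at the two ends agree, as \<open>x y z > 0\<close>.\<close>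
  have "\<exists>m x y u v w s'. s' = (x, y, m, u, v, w) \<and> steep n s' \<and> markov s' = - k \<and>
      m * (gap (rotinv s') * gap s') \<le> 0"
  proof (rule ccontr)
    assume no: "\<not> ?thesis"
    have *: "m * (gap s' * gap (rot s')) > 0"
      if "steep n (rot s')" "markov s' = - k" "rot s' = (x, y, m, u, v, w)" for s' m x y u v w
    proof -
      have "\<not> m * (gap (rotinv (rot s')) * gap (rot s')) \<le> 0"
        using no that markov_rot(1)[of s'] by metis
      then show ?thesis by simp
    qed
    have 1: "x' * (gap s * gap (rot s)) > 0"
      by (rule *) (simp_all add: s steep_rot del: rot.simps, simp add: e')
    have 2: "y' * (gap (rot s) * gap (rot (rot s))) > 0"
      by (rule *) (simp_all add: s steep_rot del: rot.simps, simp add: e')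
    have 3: "z' * (gap (rot (rot s)) * gap (rot (rot (rot s)))) > 0"
      by (rule *) (simp_all add: s steep_rot del: rot.simps, simp add: e')
    have "(x' * (gap s * gap (rot s))) * (y' * (gap (rot s) * gap (rot (rot s)))) *
        (z' * (gap (rot (rot s)) * gap (rot (rot (rot s))))) > 0"
      using 1 2 3 by (simp only: mult_pos_pos)
    then have "(x' * y' * z') * ((gap s * gap (rot (rot (rot s)))) * (gap (rot s) * gap (rot (rot s)))\<^sup>2) > 0"
      by (simp add: power2_eq_square ac_simps)
    then have "gap s * gap (rot (rot (rot s))) * (gap (rot s) * gap (rot (rot s)))\<^sup>2 > 0"
      using pos by (simp add: zero_less_mult_iff)
    then show False
      using mult_nonpos_nonneg[OF s(2) zero_le_power2[of "gap (rot s) * gap (rot (rot s))"]] by linarith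
  qed
  then obtain m x1 y1 u1 v1 w1 s' where m: "s' = (x1, y1, m, u1, v1, w1)" "steep n s'" "markov s' = - k"
    "m * (gap (rotinv s') * gap s') \<le> 0" by blast
  have "(gap t)\<^sup>2 * k \<le> \<bar>m\<bar> * twist_norm p q (- k)"
    using m(2) reducedD t(2)[OF m(2)] t(2)[OF steep_rot(2)[OF m(2)]]
    by (intro adjacent_bound[OF _ m(1) _ m(3) k0 m(4)]) (auto simp: steep_def m(1))
  moreover have "n * \<bar>m\<bar> \<le> 3 * k" using m by (simp add: steep_def)
  moreover have "k \<le> \<bar>y\<^sup>2 + v\<^sup>2 + w\<^sup>2 - y * v * w\<bar>"
    using reduced_markov_le[OF r e] k0 by (simp add: k_def)
  moreover have "markov t = - k" by (simp add: k_def)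
  ultimately have "n < bound_pos p q" unfolding bound_pos_def
    using descent_negative[OF k0 _ x(2) nk] height_equation[OF e pf[OF Q] ct[OF Q]]
      markov_product[OF e pf[OF Q] ct[OF Q]] by simp
  then show False using n by simp
qed

end

section \<open>The finite set of representatives\<close>

definition bound :: "int \<Rightarrow> int \<Rightarrow> int" where
  "bound p q = bound_nonpos p q + (bound_pos p q)\<^sup>2 + 4 + \<bar>twist_norm p q 4\<bar>"

text \<open>The condition \<open>markov t \<noteq> y\<^sup>2\<close> lets the gap and the height recover \<open>v\<close> and \<open>w\<close>; the bound on the gap
  is the one provided by a minimal twist.\<close>

definition representatives :: "int \<Rightarrow> int \<Rightarrow> state set" where
  "representatives p q = {t. pfaffian t = p \<and> cotrace t = q \<and>
     (case t of (x, y, z, u, v, w) \<Rightarrow>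
        \<bar>x\<bar> \<le> bound p q \<and> \<bar>y\<bar> \<le> bound p q \<and> \<bar>z\<bar> \<le> bound p q \<and> markov t \<noteq> y\<^sup>2 \<and>
        (gap t)\<^sup>2 \<le> \<bar>(y\<^sup>2 - markov t) * twist_norm p q (markov t)\<bar>)}"

lemma finite_abs_le: "finite {x::int. \<bar>x\<bar> \<le> b}"
  by (rule finite_subset[of _ "{-b..b}"]) auto

lemma abs_le_of_sq_le: "x\<^sup>2 \<le> b \<Longrightarrow> \<bar>x\<bar> \<le> (b::int)"
proof -
  assume "x\<^sup>2 \<le> b"
  moreover have "\<bar>x\<bar> \<le> \<bar>x\<bar>\<^sup>2" by (cases "x = 0") (simp_all add: power2_eq_square del: abs_mult_self_eq)
  ultimately show ?thesis by simp
qed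

text \<open>At \<open>k = 0\<close> the equation for the height degenerates, and \<open>markov_product\<close> becomes a linear
  equation for the height with leading coefficient \<open>p y\<close>.\<close>

lemma height_bound:
  assumes t: "t = (x, y, z, u, v, w)" and p: "pfaffian t = p" and q: "cotrace t = q"
    and p0: "p \<noteq> 0" and k: "markov t = k" and ky: "k \<noteq> y\<^sup>2"
  shows "\<bar>height t\<bar> \<le> \<bar>k * (k - 4) * (gap t)\<^sup>2 + 4 * (y\<^sup>2 - k) * twist_norm p q k\<bar> + \<bar>2 * p * y\<bar>
    + \<bar>(gap t)\<^sup>2 + p\<^sup>2 + q * y\<^sup>2\<bar>" (is "_ \<le> \<bar>?r\<bar> + _ + \<bar>?s\<bar>")
proof (cases "k = 0")
  case True
  then have "p * y * height t = ?s"
    using markov_product[OF t p q] k by simp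
  moreover have "p * y \<noteq> 0" using True ky p0 by auto
  then have "1 \<le> \<bar>p * y\<bar>" by linarith
  then have "1 * \<bar>height t\<bar> \<le> \<bar>p * y\<bar> * \<bar>height t\<bar>" by (intro mult_right_mono) auto
  ultimately show ?thesis by (simp add: abs_mult[symmetric])
next
  case False
  have "(k * height t - 2 * p * y)\<^sup>2 \<le> \<bar>?r\<bar>"
    using height_equation[OF t p q] k by simp
  then have "\<bar>k * height t - 2 * p * y\<bar> \<le> \<bar>?r\<bar>" by (rule abs_le_of_sq_le)
  then have "\<bar>k * height t\<bar> \<le> \<bar>?r\<bar> + \<bar>2 * p * y\<bar>" by linarith
  moreover have "1 * \<bar>height t\<bar> \<le> \<bar>k\<bar> * \<bar>height t\<bar>" using False by (intro mult_right_mono) auto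
  then have "\<bar>height t\<bar> \<le> \<bar>k * height t\<bar>" by (simp only: abs_mult mult_1)
  ultimately have "\<bar>height t\<bar> \<le> \<bar>?r\<bar> + \<bar>2 * p * y\<bar>" by (rule order_trans[rotated])
  also have "\<dots> \<le> \<bar>?r\<bar> + \<bar>2 * p * y\<bar> + \<bar>?s\<bar>" by (simp only: le_add_same_cancel1 abs_ge_zero)
  finally show ?thesis .
qed

lemma finite_representatives:
  assumes p0: "p \<noteq> 0"
  shows "finite (representatives p q)"
proof -
  define B where "B = {x::int. \<bar>x\<bar> \<le> bound p q}"
  define G where "G = (\<lambda>(x, y, z). let k = x\<^sup>2 + y\<^sup>2 + z\<^sup>2 - x * y * z in
     {d::int. \<bar>d\<bar> \<le> \<bar>(y\<^sup>2 - k) * twist_norm p q k\<bar>})"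
  define H where "H = (\<lambda>((x, y, z), d). let k = x\<^sup>2 + y\<^sup>2 + z\<^sup>2 - x * y * z in
     {h::int. \<bar>h\<bar> \<le> \<bar>k * (k - 4) * d\<^sup>2 + 4 * (y\<^sup>2 - k) * twist_norm p q k\<bar> + \<bar>2 * p * y\<bar>
        + \<bar>d\<^sup>2 + p\<^sup>2 + q * y\<^sup>2\<bar>})"
  define f where "f = (\<lambda>t. case t of (x, y, z, u, v, w) \<Rightarrow> (((x, y, z), gap t), height t))"
  have "finite (Sigma (Sigma (B \<times> B \<times> B) G) H)"
    by (intro finite_SigmaI finite_cartesian_product)
      (auto simp: B_def G_def H_def Let_def finite_abs_le)
  moreover have "f ` representatives p q \<subseteq> Sigma (Sigma (B \<times> B \<times> B) G) H"
  proof
    fix c assume "c \<in> f ` representatives p q"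
    then obtain x y z u v w where t: "(x, y, z, u, v, w) \<in> representatives p q"
      and c: "c = f (x, y, z, u, v, w)" by auto
    define s where "s = (x, y, z, u, v, w)"
    have s: "pfaffian s = p" "cotrace s = q" "x \<in> B" "y \<in> B" "z \<in> B" "markov s \<noteq> y\<^sup>2"
      "(gap s)\<^sup>2 \<le> \<bar>(y\<^sup>2 - markov s) * twist_norm p q (markov s)\<bar>"
      using t by (simp_all add: representatives_def s_def B_def del: gap.simps markov.simps pfaffian.simps cotrace.simps)
    have k: "markov s = x\<^sup>2 + y\<^sup>2 + z\<^sup>2 - x * y * z" by (simp add: s_def)
    have "c = (((x, y, z), gap s), height s)" by (simp add: c f_def s_def)
    moreover have "gap s \<in> G (x, y, z)"
      using abs_le_of_sq_le[OF s(7)] unfolding k by (simp add: G_def)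
    moreover have "height s \<in> H ((x, y, z), gap s)"
      using height_bound[OF s_def s(1,2) p0 HOL.refl s(6)]
      unfolding H_def Let_def prod.case mem_Collect_eq k[symmetric] .
    ultimately show "c \<in> Sigma (Sigma (B \<times> B \<times> B) G) H" using s by simp
  qed
  moreover have "inj_on f (representatives p q)"
  proof (rule inj_onI)
    fix s t assume st: "s \<in> representatives p q" "t \<in> representatives p q" "f s = f t"
    obtain x y z u v w where s: "s = (x, y, z, u, v, w)" by (cases s)
    obtain x' y' z' u' v' w' where t: "t = (x', y', z', u', v', w')" by (cases t)
    have "f s = (((x, y, z), gap s), height s)" "f t = (((x', y', z'), gap t), height t)"
      by (simp_all add: f_def s t)
    then have e: "x' = x" "y' = y" "z' = z" and g: "gap s = gap t" and h: "height s = height t"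
      using st(3) by simp_all
    have p: "pfaffian s = p" "pfaffian t = p" and ky: "markov s \<noteq> y\<^sup>2"
      using st(1,2) by (simp_all add: representatives_def s t)
    have k: "markov t = markov s" by (simp add: s t e)
    have "2 * u = height s + gap s" "2 * u' = height t + gap t" by (simp_all add: s t)
    then have u: "u' = u" using g h by simp
    have "(markov s - y\<^sup>2) * v' = (markov s - y\<^sup>2) * v" "(markov s - y\<^sup>2) * w' = (markov s - y\<^sup>2) * w"
      using last_coordinates[OF s p(1)] last_coordinates[OF t p(2)] unfolding k e u g by simp_all
    then show "s = t" using ky e u by (simp add: s t)
  qed
  ultimately show ?thesis by (meson finite_imageD finite_subset)
qed

context closed_states
begin

text \<open>The triples \<open>(2, n, n)\<close> span a degenerate form with an isotropic vector, \<open>e\<^sub>2 \<mp> e\<^sub>3\<close> for \<open>y = \<plusminus>2\<close>. If \<open>m\<close> denotes the product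
  of \<open>e\<^sub>4\<close> with that vector, then \<open>(n\<^sup>2 - 4) m\<^sup>2\<close> is the value of the characteristic polynomial at 1, and
  integrality of \<open>m\<close> bounds \<open>n\<close>.\<close>

lemma markov_four:
  assumes "t \<in> Q" and t: "t = (x, y, z, u, v, w)" and "\<bar>y\<bar> = 2" and "\<bar>x\<bar> = \<bar>z\<bar>" and "x * y * z > 0"
  shows "x\<^sup>2 \<le> 4 + \<bar>twist_norm p q 4\<bar>"
proof -
  have xz: "x\<^sup>2 = z\<^sup>2" using assms(4) by (metis power2_abs)
  have y2: "y = 2 \<or> y = -2" using assms(3) by linarith
  have "2 * x = y * z"
  proof -
    from assms(4) have "x = z \<or> x = - z" by linarith
    then show ?thesis using y2 assms(5) by (auto simp: zero_less_mult_iff)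
  qed
  then have xyz: "x * y * z = 2 * x\<^sup>2" "2 * x * y = 4 * z"
    using y2 by (auto simp: power2_eq_square)
  have k: "markov t = 4" using y2 xyz xz by (auto simp: t)
  obtain m where m: "gap t = z * m"
  proof (cases "x = z")
    case True then show thesis using that[of "v - w"] by (simp add: t algebra_simps)
  next
    case False
    then have "x = - z" using assms(4) by linarith
    then show thesis using that[of "- v - w"] by (simp add: t algebra_simps)
  qed
  have "(gap t)\<^sup>2 * (x\<^sup>2 - 4) = z\<^sup>2 * twist_norm p q 4"
    using gap_adjacent[OF t pf ct] assms(1) k xyz y2 by auto
  then have "z\<^sup>2 * (m\<^sup>2 * (x\<^sup>2 - 4)) = z\<^sup>2 * twist_norm p q 4"
    unfolding m by (simp add: power_mult_distrib ac_simps)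
  then have id: "m\<^sup>2 * (x\<^sup>2 - 4) = twist_norm p q 4" using assms(5) by auto
  then have "m \<noteq> 0" using twist_norm_4 by auto
  then have "1 \<le> m\<^sup>2" by (metis one_le_numeral power2_less_eq_zero_iff int_one_le_iff_zero_less not_le)
  then have "1 * \<bar>x\<^sup>2 - 4\<bar> \<le> m\<^sup>2 * \<bar>x\<^sup>2 - 4\<bar>" by (intro mult_right_mono) auto
  then show ?thesis unfolding id[symmetric] by (simp add: abs_mult)
qed

lemma reduced_bounded:
  assumes "reduced t" and t: "t = (x, y, z, u, v, w)"
  shows "\<bar>x\<bar> \<le> bound p q \<and> \<bar>y\<bar> \<le> bound p q \<and> \<bar>z\<bar> \<le> bound p q"
proof -
  have r: "reduced (x, y, z, u, v, w)" using assms by simp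
  have nonneg: "0 \<le> bound_nonpos p q" "8 \<le> bound_pos p q"
    by (simp_all add: bound_nonpos_def bound_pos_def)
  show ?thesis
  proof (cases "x * y * z \<le> 0")
    case True
    then show ?thesis
      using bounded_nonpos[OF r] unfolding bound_def
      using zero_le_power2[of "bound_pos p q"] by linarith
  next
    case False
    then have pos: "x * y * z > 0" by simp
    have four: "\<bar>a\<bar> \<le> bound p q \<and> 2 \<le> bound p q"
      if "(a, b, c, u', v', w') \<in> Q" "\<bar>b\<bar> = 2" "\<bar>a\<bar> = \<bar>c\<bar>" "a * b * c > 0" for a b c u' v' w'
      using abs_le_of_sq_le[OF markov_four[OF that(1) HOL.refl that(2-4)]] nonneg
        zero_le_power2[of "bound_pos p q"] unfolding bound_def by linarith
    define k where "k = \<bar>x\<bar> * \<bar>y\<bar> * \<bar>z\<bar> - \<bar>x\<bar>\<^sup>2 - \<bar>y\<bar>\<^sup>2 - \<bar>z\<bar>\<^sup>2"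
    have k: "k = - markov t" using pos by (simp add: k_def t abs_mult[symmetric])
    have "2 * \<bar>x\<bar> \<le> \<bar>y\<bar> * \<bar>z\<bar>" "2 * \<bar>y\<bar> \<le> \<bar>x\<bar> * \<bar>z\<bar>" "2 * \<bar>z\<bar> \<le> \<bar>x\<bar> * \<bar>y\<bar>"
      using vieta_minimal reduced_vieta[OF r] pos by (simp_all add: ac_simps)
    moreover have "x \<noteq> 0" "y \<noteq> 0" "z \<noteq> 0" using pos by auto
    then have "1 \<le> \<bar>x\<bar>" "1 \<le> \<bar>y\<bar>" "1 \<le> \<bar>z\<bar>" by linarith+
    ultimately consider "\<bar>x\<bar> = 2" "\<bar>y\<bar> = \<bar>z\<bar>" | "\<bar>y\<bar> = 2" "\<bar>x\<bar> = \<bar>z\<bar>" | "\<bar>z\<bar> = 2" "\<bar>x\<bar> = \<bar>y\<bar>"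
      | n where "3 \<le> \<bar>x\<bar>" "3 \<le> \<bar>y\<bar>" "3 \<le> \<bar>z\<bar>" "\<bar>x\<bar> \<le> n\<^sup>2" "\<bar>y\<bar> \<le> n\<^sup>2" "\<bar>z\<bar> \<le> n\<^sup>2" "3 \<le> n"
        "4 \<le> n \<Longrightarrow> n * \<bar>x\<bar> \<le> 3 * k \<and> n * \<bar>y\<bar> \<le> 3 * k \<and> n * \<bar>z\<bar> \<le> 3 * k"
      using markov_positive[of "\<bar>x\<bar>" "\<bar>y\<bar>" "\<bar>z\<bar>", folded k_def] by blast
    then show ?thesis
    proof cases
      case 1
      then show ?thesis
        using four[of z x y] rotinv_closed[OF reducedD[OF r]] pos by (simp add: ac_simps)
    next
      case 2
      then show ?thesis using four[of x y z] reducedD[OF r] pos by simp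
    next
      case 3
      then show ?thesis
        using four[of y z x] rot_closed[OF reducedD[OF r]] pos by (simp add: ac_simps)
    next
      case 4
      have "n < bound_pos p q"
      proof (cases "4 \<le> n")
        case True
        then have "steep n t" using 4 assms pos k by (simp add: steep_def t)
        then show ?thesis using steep_bound True by simp
      qed (use nonneg in simp)
      then have "n\<^sup>2 \<le> (bound_pos p q)\<^sup>2" using 4(7) by (intro power_mono) auto
      then show ?thesis using 4(4-6) nonneg unfolding bound_def by linarith
    qed
  qed
qed

text \<open>If all three squares were equal to \<open>K\<close>, then \<open>K = 0\<close> and \<open>x = y = z = 0\<close>, so that \<open>p = 0\<close>, or \<open>K = 4\<close> and the
  triple is \<open>(2, 2, 2)\<close> up to signs, for which the characteristic polynomial vanishes at 1.\<close>

lemma reduced_nondegenerate: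
  assumes "reduced t" and t: "t = (x, y, z, u, v, w)"
  shows "markov t \<noteq> x\<^sup>2 \<or> markov t \<noteq> y\<^sup>2 \<or> markov t \<noteq> z\<^sup>2"
proof (rule ccontr)
  assume "\<not> ?thesis"
  then have k: "x\<^sup>2 = y\<^sup>2" "z\<^sup>2 = y\<^sup>2" "x * y * z = 2 * y\<^sup>2" by (auto simp: t)
  have "(x * y * z)\<^sup>2 = x\<^sup>2 * y\<^sup>2 * z\<^sup>2" by (simp add: power_mult_distrib)
  then have "y\<^sup>2 * y\<^sup>2 * (y\<^sup>2 - 4) = 0"
    unfolding k by (simp add: algebra_simps power2_eq_square)
  then have "y = 0 \<or> y\<^sup>2 = 4" by auto
  then show False
  proof
    assume "y = 0"
    then have "x = 0" "y = 0" "z = 0" using k by auto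
    then show False using pf[OF reducedD[OF assms(1)]] p_nonzero by (simp add: t)
  next
    assume y: "y\<^sup>2 = 4"
    then have "markov t = 4" using k by (simp add: t)
    then have "z\<^sup>2 * twist_norm p q 4 = (gap (rotinv t)) * gap t * (z * 4 - 2 * x * y)"
      using gap_adjacent[OF t pf ct] reducedD[OF assms(1)] k y by simp
    moreover have "x * y * z\<^sup>2 = z * (x * y * z)" by (simp add: power2_eq_square)
    then have "z * 4 - 2 * x * y = 0" using k y by simp
    ultimately show False using twist_norm_4 k y by simp
  qed
qed

text \<open>A reduced state, rotated until \<open>K \<noteq> y\<^sup>2\<close> and twisted until the gap is minimal. The twist is hyperbolic
  unless \<open>0 \<le> K \<le> 4\<close>. It is elliptic for \<open>K\<close> between 1 and 3, where the invariant form is definite,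
  and parabolic for \<open>K = 0\<close> and \<open>K = 4\<close>, where it moves the gap by nonzero steps because
  neither \<open>p\<close> nor \<open>twist_norm p q 4\<close> vanishes.\<close>

lemma meets_representatives: "\<exists>t\<in>Q. t \<in> representatives p q"
proof -
  obtain r where r: "reduced r" using reduced_exists ..
  obtain x y z u v w where rt: "r = (x, y, z, u, v, w)" by (cases r)
  have "\<exists>s x y z u v w. reduced s \<and> s = (x, y, z, u, v, w) \<and> markov s \<noteq> y\<^sup>2"
    using reduced_nondegenerate[OF r rt] r reduced_rot[OF r] markov_rot[of r]
    unfolding rt rot.simps rotinv.simps by metis
  then obtain s a b c u v w where s: "reduced s" "s = (a, b, c, u, v, w)" "markov s \<noteq> b\<^sup>2" by blast
  define A where "A = (\<lambda>t. reduced t \<and> (\<exists>u v w. t = (a, b, c, u, v, w)))"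
  have "A s" using s by (auto simp: A_def)
  then obtain t where t: "A t" "\<And>s. A s \<Longrightarrow> \<bar>gap t\<bar> \<le> \<bar>gap s\<bar>"
    using gap_minimal[of A] by blast
  then obtain u v w where e: "t = (a, b, c, u, v, w)" and red: "reduced t" by (auto simp: A_def)
  have Q: "t \<in> Q" by (rule reducedD[OF red])
  have "A (rot (rot (rot t)))" "A (rotinv (rotinv (rotinv t)))"
    using e red by (auto simp: A_def reduced_rot simp del: rot.simps rotinv.simps)
      (auto simp: e)
  note tw = twist_bound[OF Q e t(2)[OF this(1)] t(2)[OF this(2)]]
  define k where "k = markov t"
  define d where "d = (b\<^sup>2 - k) * twist_norm p q k"
  have kb: "k \<noteq> b\<^sup>2" using s by (simp add: k_def e)
  have h: "(k * height t - 2 * p * b)\<^sup>2 = k * (k - 4) * (gap t)\<^sup>2 + 4 * d"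
    using height_equation[OF e pf[OF Q] ct[OF Q]] by (simp add: k_def d_def)
  have "(gap t)\<^sup>2 \<le> \<bar>d\<bar>"
  proof (cases "d > 0")
    case True
    then show ?thesis using tw(1) unfolding d_def k_def by simp
  next
    case False
    then have d: "d \<le> 0" by simp
    have m: "(\<bar>2 - k\<bar> - 2) * (gap t)\<^sup>2 \<le> - d" using tw(2) d unfolding d_def k_def by simp
    consider "k < 0 \<or> 4 < k" | "k = 0" | "k = 4" | "k \<in> {1, 2, 3}" by force
    then show ?thesis
    proof cases
      case 1
      then have "1 * (gap t)\<^sup>2 \<le> (\<bar>2 - k\<bar> - 2) * (gap t)\<^sup>2" by (intro mult_right_mono) auto
      then show ?thesis using m by linarith
    next
      case 2
      then have "d > 0" using kb p_nonzero by (simp add: d_def twist_norm_def)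
      then show ?thesis using d by simp
    next
      case 3
      then have "d \<ge> 0" using h zero_le_power2[of "k * height t - 2 * p * b"] by simp
      moreover have "d \<noteq> 0" using 3 kb twist_norm_4 by (simp add: d_def)
      ultimately show ?thesis using d by simp
    next
      case 4
      then have "3 * (gap t)\<^sup>2 \<le> k * (4 - k) * (gap t)\<^sup>2" by (intro mult_right_mono) auto
      moreover have "k * (4 - k) * (gap t)\<^sup>2 \<le> 4 * d"
      proof -
        have "k * (4 - k) * (gap t)\<^sup>2 + k * (k - 4) * (gap t)\<^sup>2 = 0" by (simp add: algebra_simps)
        then show ?thesis using h zero_le_power2[of "k * height t - 2 * p * b"] by linarith
      qed
      ultimately show ?thesis using d zero_le_power2[of "gap t"] by linarith
    qed
  qed
  then have "t \<in> representatives p q"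
    using reduced_bounded[OF red e] pf[OF Q] ct[OF Q] kb
    unfolding representatives_def d_def k_def e by simp
  then show ?thesis using Q by blast
qed

end

section \<open>Characteristic polynomial and orbits of Stokes matrices\<close>

lemma det_first_row:
  assumes "(A :: 'a :: comm_ring_1 mat) \<in> carrier_mat (Suc n) (Suc n)"
  shows "det A = (\<Sum>j<Suc n. A $$ (0, j) * ((- 1) ^ j * det (mat_delete A 0 j)))"
  using laplace_expansion_row[OF assms, of 0] by (simp add: cofactor_def)

lemma mat_delete_first_row:
  assumes "A \<in> carrier_mat (Suc n) (Suc n)"
  shows "mat_delete A 0 j \<in> carrier_mat n n"
    "i < n \<Longrightarrow> k < n \<Longrightarrow> mat_delete A 0 j $$ (i, k) = A $$ (Suc i, if k < j then k else Suc k)"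
  using assms by (auto simp: mat_delete_def)

lemma det_dim_2:
  assumes "(A :: 'a :: comm_ring_1 mat) \<in> carrier_mat 2 2"
  shows "det A = A $$ (0, 0) * A $$ (1, 1) - A $$ (0, 1) * A $$ (1, 0)"
proof -
  have A: "A \<in> carrier_mat (Suc 1) (Suc 1)" using assms by (simp add: numeral_2_eq_2)
  note m = mat_delete_first_row[OF A]
  show ?thesis
    unfolding det_first_row[OF A] det_single[OF m(1)] by (simp add: m(2))
qed

lemma det_dim_3:
  assumes "(A :: 'a :: comm_ring_1 mat) \<in> carrier_mat 3 3"
  shows "det A = A $$ (0, 0) * (A $$ (1, 1) * A $$ (2, 2) - A $$ (1, 2) * A $$ (2, 1))
    - A $$ (0, 1) * (A $$ (1, 0) * A $$ (2, 2) - A $$ (1, 2) * A $$ (2, 0))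
    + A $$ (0, 2) * (A $$ (1, 0) * A $$ (2, 1) - A $$ (1, 1) * A $$ (2, 0))"
proof -
  have A: "A \<in> carrier_mat (Suc 2) (Suc 2)" using assms by simp
  note m = mat_delete_first_row[OF A]
  show ?thesis
    unfolding det_first_row[OF A] det_dim_2[OF m(1)]
    by (simp add: m(2) numeral_2_eq_2 numeral_3_eq_3 right_diff_distrib)
qed

lemma det_dim_4:
  assumes "(A :: 'a :: comm_ring_1 mat) \<in> carrier_mat 4 4"
  defines "m \<equiv> \<lambda>i j k. A $$ (1, i) * (A $$ (2, j) * A $$ (3, k) - A $$ (2, k) * A $$ (3, j))
    - A $$ (1, j) * (A $$ (2, i) * A $$ (3, k) - A $$ (2, k) * A $$ (3, i))
    + A $$ (1, k) * (A $$ (2, i) * A $$ (3, j) - A $$ (2, j) * A $$ (3, i))"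
  shows "det A = A $$ (0, 0) * m 1 2 3 - A $$ (0, 1) * m 0 2 3 + A $$ (0, 2) * m 0 1 3 - A $$ (0, 3) * m 0 1 2"
proof -
  have A: "A \<in> carrier_mat (Suc 3) (Suc 3)" using assms by simp
  note d = mat_delete_first_row[OF A]
  show ?thesis
    unfolding det_first_row[OF A] det_dim_3[OF d(1)] m_def
    by (simp add: d(2) numeral_2_eq_2 numeral_3_eq_3 algebra_simps)
qed

text \<open>The coefficient of \<open>\<lambda>\<^sup>3\<close> in \<open>det (\<lambda> s + s\<^sup>T)\<close>, and the Pfaffian of \<open>s - s\<^sup>T\<close>.\<close>

definition trace_coeff :: "complex mat \<Rightarrow> complex" where
  "trace_coeff s = (let a = s $$ (0, 1); b = s $$ (0, 2); c = s $$ (0, 3);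
      d = s $$ (1, 2); e = s $$ (1, 3); f = s $$ (2, 3) in
    4 - a\<^sup>2 - b\<^sup>2 - c\<^sup>2 - d\<^sup>2 - e\<^sup>2 - f\<^sup>2 + a * b * d + a * c * e + b * c * f + d * e * f - a * d * f * c)"

definition pf_entry :: "complex mat \<Rightarrow> complex" where
  "pf_entry s = s $$ (0, 1) * s $$ (2, 3) - s $$ (0, 2) * s $$ (1, 3) + s $$ (0, 3) * s $$ (1, 2)"

lemma det_stokes:
  assumes "s \<in> stokes r"
  shows "det s = 1"
proof -
  have s: "s \<in> carrier_mat r r" "upper_triangular s" "\<forall>i<r. s $$ (i, i) = 1"
    using assms by (auto simp: stokes_def)
  then have "diag_mat s = replicate r 1"
    by (intro nth_equalityI) (auto simp: diag_mat_def)
  then show ?thesis using det_upper_triangular[OF s(2,1)] by simp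
qed

text \<open>Since \<open>det s = 1\<close>, the determinant is that of \<open>x s + s\<^sup>T\<close>. At \<open>x = -1\<close> this matrix is skew, which is why
  the remaining coefficient is governed by the square of a Pfaffian.\<close>

lemma stokes_char_poly:
  assumes s: "s \<in> stokes 4"
  shows "det (x \<cdot>\<^sub>m 1\<^sub>m 4 + the (mat_inverse s) * transpose_mat s) =
    x ^ 4 + trace_coeff s * x ^ 3 + ((pf_entry s)\<^sup>2 - 2 + 2 * trace_coeff s) * x\<^sup>2 + trace_coeff s * x + 1"
proof -
  note sD = stokesD[OF s]
  obtain t where t: "mat_inverse s = Some t" using stokes_invertible[OF s] by blast
  then have inv: "s * t = 1\<^sub>m 4" "t \<in> carrier_mat 4 4" using mat_inverse(2)[OF sD(1) t] by auto
  let ?M = "x \<cdot>\<^sub>m 1\<^sub>m 4 + t * transpose_mat s"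
  have M: "?M \<in> carrier_mat 4 4" using inv sD by auto
  have "s * ?M = s * (x \<cdot>\<^sub>m 1\<^sub>m 4) + s * (t * transpose_mat s)"
    using inv sD by (intro mult_add_distrib_mat) auto
  also have "s * (t * transpose_mat s) = transpose_mat s"
    using inv sD by (subst assoc_mult_mat[symmetric, of _ 4 4 _ 4 _ 4]) auto
  also have "s * (x \<cdot>\<^sub>m 1\<^sub>m 4) = x \<cdot>\<^sub>m s"
    using sD mult_smult_distrib[of s 4 4 "1\<^sub>m 4" 4 x] by simp
  finally have "det ?M = det (x \<cdot>\<^sub>m s + transpose_mat s)"
    using det_mult[OF sD(1) M] det_stokes[OF s] by simp
  also have "\<dots> = x ^ 4 + trace_coeff s * x ^ 3 + ((pf_entry s)\<^sup>2 - 2 + 2 * trace_coeff s) * x\<^sup>2 + trace_coeff s * x + 1"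
  proof -
    have "x \<cdot>\<^sub>m s + transpose_mat s \<in> carrier_mat 4 4" using sD by auto
    note d = det_dim_4[OF this]
    have e: "(x \<cdot>\<^sub>m s + transpose_mat s) $$ (i, j) = x * s $$ (i, j) + s $$ (j, i)"
      if "i < 4" "j < 4" for i j using that sD by auto
    show ?thesis
      unfolding d trace_coeff_def pf_entry_def Let_def
      by (simp add: e sD algebra_simps power2_eq_square power3_eq_cube power4_eq_xxxx)
  qed
  finally show ?thesis unfolding t by simp
qed

lemma stokes_variety_4:
  "s \<in> stokes_variety 4 P \<longleftrightarrow> s \<in> stokes 4 \<and> (\<forall>x. poly P x =
    x ^ 4 + trace_coeff s * x ^ 3 + ((pf_entry s)\<^sup>2 - 2 + 2 * trace_coeff s) * x\<^sup>2 + trace_coeff s * x + 1)"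
  unfolding stokes_variety_def using stokes_char_poly by auto

lemma braid_gen_entries:
  assumes s: "s \<in> stokes 4"
  shows "braid_gen 4 1 s $$ (0, 1) = s $$ (0, 1)"
    "braid_gen 4 1 s $$ (0, 2) = s $$ (0, 1) * s $$ (0, 2) - s $$ (1, 2)"
    "braid_gen 4 1 s $$ (0, 3) = s $$ (0, 1) * s $$ (0, 3) - s $$ (1, 3)"
    "braid_gen 4 1 s $$ (1, 2) = s $$ (0, 2)"
    "braid_gen 4 1 s $$ (1, 3) = s $$ (0, 3)"
    "braid_gen 4 1 s $$ (2, 3) = s $$ (2, 3)"
    "braid_gen 4 2 s $$ (0, 1) = s $$ (1, 2) * s $$ (0, 1) - s $$ (0, 2)"
    "braid_gen 4 2 s $$ (0, 2) = s $$ (0, 1)"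
    "braid_gen 4 2 s $$ (0, 3) = s $$ (0, 3)"
    "braid_gen 4 2 s $$ (1, 2) = s $$ (1, 2)"
    "braid_gen 4 2 s $$ (1, 3) = s $$ (1, 2) * s $$ (1, 3) - s $$ (2, 3)"
    "braid_gen 4 2 s $$ (2, 3) = s $$ (1, 3)"
    "braid_gen 4 3 s $$ (0, 1) = s $$ (0, 1)"
    "braid_gen 4 3 s $$ (0, 2) = s $$ (2, 3) * s $$ (0, 2) - s $$ (0, 3)"
    "braid_gen 4 3 s $$ (0, 3) = s $$ (0, 2)"
    "braid_gen 4 3 s $$ (1, 2) = s $$ (2, 3) * s $$ (1, 2) - s $$ (1, 3)"
    "braid_gen 4 3 s $$ (1, 3) = s $$ (1, 2)"
    "braid_gen 4 3 s $$ (2, 3) = s $$ (2, 3)"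
proof -
  note sD = stokesD[OF s]
  have n: "(1::nat) = Suc 0" "(2::nat) = Suc 1" "(3::nat) = Suc 2" by simp_all
  note g = arg_cong[of _ _ "braid_gen 4", OF n(1)] arg_cong[of _ _ "braid_gen 4", OF n(2)]
    arg_cong[of _ _ "braid_gen 4", OF n(3)]
  show "braid_gen 4 1 s $$ (0, 1) = s $$ (0, 1)"
    "braid_gen 4 1 s $$ (0, 2) = s $$ (0, 1) * s $$ (0, 2) - s $$ (1, 2)"
    "braid_gen 4 1 s $$ (0, 3) = s $$ (0, 1) * s $$ (0, 3) - s $$ (1, 3)"
    "braid_gen 4 1 s $$ (1, 2) = s $$ (0, 2)"
    "braid_gen 4 1 s $$ (1, 3) = s $$ (0, 3)"
    "braid_gen 4 1 s $$ (2, 3) = s $$ (2, 3)"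
    "braid_gen 4 2 s $$ (0, 1) = s $$ (1, 2) * s $$ (0, 1) - s $$ (0, 2)"
    "braid_gen 4 2 s $$ (0, 2) = s $$ (0, 1)"
    "braid_gen 4 2 s $$ (0, 3) = s $$ (0, 3)"
    "braid_gen 4 2 s $$ (1, 2) = s $$ (1, 2)"
    "braid_gen 4 2 s $$ (1, 3) = s $$ (1, 2) * s $$ (1, 3) - s $$ (2, 3)"
    "braid_gen 4 2 s $$ (2, 3) = s $$ (1, 3)"
    "braid_gen 4 3 s $$ (0, 1) = s $$ (0, 1)"
    "braid_gen 4 3 s $$ (0, 2) = s $$ (2, 3) * s $$ (0, 2) - s $$ (0, 3)"
    "braid_gen 4 3 s $$ (0, 3) = s $$ (0, 2)"
    "braid_gen 4 3 s $$ (1, 2) = s $$ (2, 3) * s $$ (1, 2) - s $$ (1, 3)"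
    "braid_gen 4 3 s $$ (1, 3) = s $$ (1, 2)"
    "braid_gen 4 3 s $$ (2, 3) = s $$ (2, 3)"
    unfolding g
    by (subst braid_gen_index[OF _ sD(1)]; simp add: sD(2,3) Let_def numeral_2_eq_2 numeral_3_eq_3)+
qed

lemma braid_invariants:
  assumes s: "s \<in> stokes 4" and "i \<in> {1..<4}"
  shows "trace_coeff (braid_gen 4 i s) = trace_coeff s" "pf_entry (braid_gen 4 i s) = pf_entry s"
proof -
  have "i = 1 \<or> i = 2 \<or> i = 3" using assms(2) by auto
  then show "trace_coeff (braid_gen 4 i s) = trace_coeff s"
    unfolding trace_coeff_def Let_def
    by (elim disjE) (simp_all only: braid_gen_entries[OF s], (simp add: algebra_simps power2_eq_square)+)
  from \<open>i = 1 \<or> i = 2 \<or> i = 3\<close> show "pf_entry (braid_gen 4 i s) = pf_entry s"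
    unfolding pf_entry_def
    by (elim disjE) (simp_all only: braid_gen_entries[OF s], (simp add: algebra_simps)+)
qed

lemma inv_into_braid_gen:
  assumes "s \<in> stokes r" and "i \<in> {1..<r}"
  shows "inv_into (stokes r) (braid_gen r i) s = braid_gen_inv r i s"
proof -
  obtain p where i: "i = Suc p" "Suc p < r" using assms(2) by (cases i) auto
  show ?thesis
    using bij_betw_braid_gen[OF assms(2)] braid_gen_stokes(3)[OF i(2) assms(1)]
      braid_gen_inverse(1)[OF i(2) assms(1)]
    unfolding i(1) by (intro inv_into_f_eq) (auto simp: bij_betw_def)
qed

text \<open>Orbits are defined through the presented group; a property preserved by the generators and by their
  inverses passes to the whole orbit, by induction on a word.\<close>

lemma braid_orbit_induct:
  assumes "s' \<in> orbit (braid_group r) (braid_action r) s" and s: "s \<in> stokes r" "P s"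
    and gen: "\<And>t i. t \<in> stokes r \<Longrightarrow> i \<in> {1..<r} \<Longrightarrow> P t \<Longrightarrow> P (braid_gen r i t)"
    and inv: "\<And>t i. t \<in> stokes r \<Longrightarrow> i \<in> {1..<r} \<Longrightarrow> P t \<Longrightarrow> P (braid_gen_inv r i t)"
  shows "P s'"
proof -
  obtain w where w: "w \<in> gwords {1..<r}" "s' = braid_action r (braid_class r w) s"
    using assms(1) by (auto simp: orbit_def braid_group_def carrier_presented_group simp del: One_nat_def)
  have "P (braid_word_act r w s)" using w(1)
  proof (induction w)
    case (Cons g w)
    obtain i b where g: "g = (i, b)" by force
    then have i: "i \<in> {1..<r}" and w: "w \<in> gwords {1..<r}" using Cons.prems by auto
    show ?case
      using gen inv Cons.IH[OF w] braid_word_act_stokes[OF w s(1)] i inv_into_braid_gen[OF _ i]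
      by (simp add: g)
  qed (use s in simp)
  then show ?thesis using braid_action_class[OF w(1) s(1)] w(2) by simp
qed

lemma braid_gen_in_orbit:
  assumes "s \<in> stokes r" and "i \<in> {1..<r}"
  shows "braid_gen r i s \<in> orbit (braid_group r) (braid_action r) s"
proof -
  have "braid_class r [(i, True)] \<in> carrier (braid_group r)"
    using assms(2) by (simp add: braid_group_def carrier_presented_group del: One_nat_def)
  then show ?thesis
    using braid_action_generator[OF assms(2,1)] unfolding orbit_def by force
qed

lemma integral_mat_iff:
  assumes "s \<in> carrier_mat r r"
  shows "integral_mat s \<longleftrightarrow> (\<forall>i<r. \<forall>j<r. s $$ (i, j) \<in> \<int>)"
proof -
  have "elements_mat s = (\<lambda>(i, j). s $$ (i, j)) ` ({0..<r} \<times> {0..<r})"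
    using assms unfolding elements_mat_def by auto
  then show ?thesis unfolding integral_mat_def by (auto simp: image_subset_iff)
qed

lemma integral_braid_gen:
  assumes s: "s \<in> stokes r" "integral_mat s" and i: "i \<in> {1..<r}"
  shows "integral_mat (braid_gen r i s)" "integral_mat (braid_gen_inv r i s)"
proof -
  obtain p where p: "i = Suc p" "Suc p < r" using i by (cases i) auto
  note sD = stokesD(1)[OF s(1)]
  have e: "s $$ (j, k) \<in> \<int>" if "j < r" "k < r" for j k
    using s(2) that unfolding integral_mat_iff[OF sD] by blast
  have "s $$ (p, Suc p) \<in> \<int>" using p(2) by (intro e) auto
  then have "braid_gen r i s $$ (j, k) \<in> \<int>" "braid_gen_inv r i s $$ (j, k) \<in> \<int>"
    if "j < r" "k < r" for j k
    using p that e Suc_lessD[OF p(2)]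
    unfolding p(1) braid_gen_index[OF p(2) sD that] braid_gen_inv_index[OF p(2) sD that] Let_def
    by (cases "j = p"; cases "j = Suc p"; cases "k = p"; cases "k = Suc p";
        simp add: Ints_mult Ints_diff)+
  then show "integral_mat (braid_gen r i s)" "integral_mat (braid_gen_inv r i s)"
    using braid_gen_carrier[OF p(2) sD] unfolding p(1) by (simp_all add: integral_mat_iff)
qed

lemma integral_stokes_variety_orbit:
  assumes s: "s \<in> stokes_variety 4 P" "integral_mat s"
    and "s' \<in> orbit (braid_group 4) (braid_action 4) s"
  shows "s' \<in> stokes_variety 4 P \<and> integral_mat s' \<and> pf_entry s' = pf_entry s \<and> trace_coeff s' = trace_coeff s"
proof -
  define A where "A = (\<lambda>t. t \<in> stokes 4 \<and> integral_mat t \<and> pf_entry t = pf_entry s \<and> trace_coeff t = trace_coeff s)"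
  have st: "s \<in> stokes 4" using s by (simp add: stokes_variety_def)
  have "A s'"
  proof (rule braid_orbit_induct[OF assms(3) st])
    fix t and i :: nat assume t: "t \<in> stokes 4" and i: "i \<in> {1..<4}" and A: "A t"
    obtain p where p: "i = Suc p" "Suc p < 4" using i by (cases i) auto
    have g: "braid_gen 4 i t \<in> stokes 4" "braid_gen_inv 4 i t \<in> stokes 4"
      "braid_gen 4 i (braid_gen_inv 4 i t) = t"
      using braid_gen_stokes(1,3)[OF p(2) t] braid_gen_inverse(1)[OF p(2) t] unfolding p by simp_all
    show "A (braid_gen 4 i t)"
      using A g integral_braid_gen[OF t _ i] braid_invariants[OF t i] by (simp add: A_def)
    show "A (braid_gen_inv 4 i t)"
      using A g integral_braid_gen[OF t _ i] braid_invariants[OF g(2) i] by (simp add: A_def)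
  qed (use s st in \<open>simp add: A_def\<close>)
  then show ?thesis using s(1) unfolding stokes_variety_4 A_def by simp
qed

text \<open>A common root of \<open>p\<close> and its derivative is a common factor, and the resultant detects common factors.\<close>

lemma discriminant_multiple_root:
  assumes "poly p a = 0" and "poly (pderiv p) a = 0" and "p \<noteq> 0"
  shows "discriminant p = 0"
proof -
  have "[:- a, 1:] dvd gcd p (pderiv p)"
    using assms by (simp add: poly_eq_0_iff_dvd)
  moreover have "gcd p (pderiv p) \<noteq> 0" using assms(3) by simp
  ultimately have "degree (gcd p (pderiv p)) \<noteq> 0"
    using dvd_imp_degree_le[of "[:- a, 1:]" "gcd p (pderiv p)"] by simp
  then have "resultant p (pderiv p) = 0" using resultant_0_gcd by blast
  then show ?thesis by (simp add: discriminant_def)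
qed

section \<open>From orbits of matrices to sets of states\<close>

fun stokes_of :: "state \<Rightarrow> complex mat" where
  "stokes_of (x, y, z, u, v, w) = mat 4 4 (\<lambda>(i, j). of_int (
     if i = j then 1 else if (i, j) = (0, 1) then x else if (i, j) = (0, 2) then x * y - z
     else if (i, j) = (0, 3) then u else if (i, j) = (1, 2) then y
     else if (i, j) = (1, 3) then v else if (i, j) = (2, 3) then w else 0))"

lemma stokes_of_entries:
  "stokes_of (x, y, z, u, v, w) $$ (0, 1) = of_int x"
  "stokes_of (x, y, z, u, v, w) $$ (0, 2) = of_int (x * y - z)"
  "stokes_of (x, y, z, u, v, w) $$ (0, 3) = of_int u"
  "stokes_of (x, y, z, u, v, w) $$ (1, 2) = of_int y"
  "stokes_of (x, y, z, u, v, w) $$ (1, 3) = of_int v"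
  "stokes_of (x, y, z, u, v, w) $$ (2, 3) = of_int w"
  by simp_all

lemma stokes_of_stokes: "stokes_of t \<in> stokes 4"
  by (cases t, rule stokesI) auto

declare stokes_of.simps [simp del]

lemma stokes_eqI:
  assumes s: "s \<in> stokes 4" and t: "t \<in> stokes 4"
    and "s $$ (0, 1) = t $$ (0, 1)" "s $$ (0, 2) = t $$ (0, 2)" "s $$ (0, 3) = t $$ (0, 3)"
      "s $$ (1, 2) = t $$ (1, 2)" "s $$ (1, 3) = t $$ (1, 3)" "s $$ (2, 3) = t $$ (2, 3)"
  shows "s = t"
proof (rule eq_matI)
  note st = stokesD[OF s] stokesD[OF t]
  fix i j assume "i < dim_row t" "j < dim_col t"
  then have ij: "i < 4" "j < 4" using st by auto
  have "j < i \<or> i = j \<or> (i, j) \<in> {(0, 1), (0, 2), (0, 3), (1, 2), (1, 3), (2, 3)}" using ij by auto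
  then show "s $$ (i, j) = t $$ (i, j)" using assms st ij by auto
qed (use stokesD[OF s] stokesD[OF t] in auto)

lemma integral_stokes_cases:
  assumes s: "s \<in> stokes 4" and "integral_mat s"
  obtains t where "s = stokes_of t"
proof -
  have "\<exists>k. s $$ (i, j) = of_int k" if "i < 4" "j < 4" for i j
    using assms that unfolding integral_mat_iff[OF stokesD(1)[OF s]] by (metis Ints_cases)
  then obtain e where e: "\<And>i j. i < 4 \<Longrightarrow> j < 4 \<Longrightarrow> s $$ (i, j) = of_int (e i j)" by metis
  have "s = stokes_of (e 0 1, e 1 2, e 0 1 * e 1 2 - e 0 2, e 0 3, e 1 3, e 2 3)"
    by (rule stokes_eqI[OF s stokes_of_stokes]) (simp_all only: stokes_of_entries, simp_all add: e)
  then show thesis by (rule that)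
qed

lemma stokes_of_invariants:
  "pf_entry (stokes_of t) = of_int (pfaffian t)"
  "trace_coeff (stokes_of t) = of_int (4 - cotrace t)"
proof -
  obtain x y z u v w where t: "t = (x, y, z, u, v, w)" by (cases t)
  show "pf_entry (stokes_of t) = of_int (pfaffian t)"
    unfolding t pf_entry_def stokes_of_entries by simp
  show "trace_coeff (stokes_of t) = of_int (4 - cotrace t)"
    unfolding t trace_coeff_def stokes_of_entries Let_def
    by (simp add: algebra_simps power2_eq_square)
qed

lemma braid_gen_stokes_4:
  assumes "s \<in> stokes 4"
  shows "braid_gen 4 1 s \<in> stokes 4" "braid_gen 4 2 s \<in> stokes 4" "braid_gen 4 3 s \<in> stokes 4"
  using braid_gen_stokes(1)[OF _ assms, of 0] braid_gen_stokes(1)[OF _ assms, of 1]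
    braid_gen_stokes(1)[OF _ assms, of 2] by (simp_all add: numeral_3_eq_3 numeral_2_eq_2)

lemma stokes_of_vieta: "stokes_of (vieta t) = braid_gen 4 1 (stokes_of t)"
proof -
  obtain x y z u v w where t: "t = (x, y, z, u, v, w)" by (cases t)
  show ?thesis
    by (rule stokes_eqI[OF stokes_of_stokes braid_gen_stokes_4(1)[OF stokes_of_stokes]])
      (simp_all only: t vieta.simps braid_gen_entries[OF stokes_of_stokes] stokes_of_entries, simp_all)
qed

text \<open>Rotation and the change to the last three vectors involve inverse generators; it is simpler to state
  them as equations for the generators.\<close>

lemma stokes_of_rot: "stokes_of t = braid_gen 4 1 (braid_gen 4 2 (stokes_of (rot t)))"
proof -
  obtain x y z u v w where t: "t = (x, y, z, u, v, w)" by (cases t)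
  note g = braid_gen_stokes_4(2)[OF stokes_of_stokes]
  show ?thesis
    by (rule stokes_eqI[OF stokes_of_stokes braid_gen_stokes_4(1)[OF g]])
      (simp_all only: t rot.simps braid_gen_entries[OF g] braid_gen_entries[OF stokes_of_stokes]
        stokes_of_entries, simp_all add: algebra_simps)
qed

lemma stokes_of_drop:
  fixes x y z u v w :: int
  defines "g \<equiv> u - x * v + z * w"
  shows "stokes_of (rot (x, y, z, u, v, w)) =
    braid_gen 4 3 (stokes_of (y, w, y * w - v, g * v - y * z + x, g * w - z, g))"
  by (rule stokes_eqI[OF stokes_of_stokes braid_gen_stokes_4(3)[OF stokes_of_stokes]])
    (simp_all only: rot.simps braid_gen_entries[OF stokes_of_stokes] stokes_of_entries,
      simp_all add: g_def algebra_simps)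

interpretation braid4: group_action "braid_group 4" "stokes 4" "braid_action 4"
  by (rule group_action_braid)

abbreviation braid_orbit :: "complex mat \<Rightarrow> complex mat set" where
  "braid_orbit \<equiv> orbit (braid_group 4) (braid_action 4)"

lemma braid_orbit_eq:
  assumes "s \<in> stokes 4" and "s' \<in> stokes 4" and "s' \<in> braid_orbit s"
  shows "braid_orbit s' = braid_orbit s"
proof -
  have "braid_orbit s \<in> orbits (braid_group 4) (stokes 4) (braid_action 4)"
    "braid_orbit s' \<in> orbits (braid_group 4) (stokes 4) (braid_action 4)"
    using assms by (auto simp: orbits_def)
  then show ?thesis using braid4.disjoint_union assms braid4.orbit_refl by blast
qed

lemma braid_orbit_gen:
  assumes "s \<in> stokes 4" and "i \<in> {1, 2, 3}"
  shows "braid_orbit (braid_gen 4 i s) = braid_orbit s"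
proof -
  have i: "i \<in> {1..<4}" using assms(2) by auto
  have "braid_gen 4 i s \<in> stokes 4" using assms braid_gen_stokes_4 by auto
  then show ?thesis using braid_orbit_eq braid_gen_in_orbit[OF assms(1) i] assms(1) by blast
qed

lemma state_moves:
  "braid_orbit (stokes_of (vieta t)) = braid_orbit (stokes_of t)"
  "braid_orbit (stokes_of (rot t)) = braid_orbit (stokes_of t)"
  "braid_orbit (stokes_of (rotinv t)) = braid_orbit (stokes_of t)"
proof -
  note g = stokes_of_stokes braid_gen_stokes_4(2)[OF stokes_of_stokes]
  show "braid_orbit (stokes_of (vieta t)) = braid_orbit (stokes_of t)"
    unfolding stokes_of_vieta by (rule braid_orbit_gen[OF g(1)]) simp
  have r: "braid_orbit (stokes_of (rot t)) = braid_orbit (stokes_of t)" for t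
    unfolding stokes_of_rot[of t] using braid_orbit_gen[OF g(1)] braid_orbit_gen[OF g(2)] by simp
  show "braid_orbit (stokes_of (rot t)) = braid_orbit (stokes_of t)" by (rule r)
  show "braid_orbit (stokes_of (rotinv t)) = braid_orbit (stokes_of t)"
    using r[of "rotinv t"] by simp
qed

lemma state_drop:
  "\<exists>u' v' w'. braid_orbit (stokes_of (y, w, y * w - v, u', v', w')) = braid_orbit (stokes_of (x, y, z, u, v, w))"
  using state_moves(2)[of "(x, y, z, u, v, w)"] unfolding stokes_of_drop
  using braid_orbit_gen[OF stokes_of_stokes] by blast

lemma orbit_representative:
  assumes t: "stokes_of t \<in> stokes_variety 4 P" and "integral_mat (stokes_of t)"
    and p0: "pfaffian t \<noteq> 0" and d0: "twist_norm (pfaffian t) (cotrace t) 4 \<noteq> 0"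
  shows "\<exists>r\<in>representatives (pfaffian t) (cotrace t). braid_orbit (stokes_of t) = braid_orbit (stokes_of r)"
proof -
  define Q where "Q = {r. braid_orbit (stokes_of r) = braid_orbit (stokes_of t)}"
  have inv: "pfaffian r = pfaffian t \<and> cotrace r = cotrace t" if "r \<in> Q" for r
  proof -
    have "stokes_of r \<in> braid_orbit (stokes_of t)"
      using that braid4.orbit_refl[OF stokes_of_stokes, of r] by (simp add: Q_def)
    from integral_stokes_variety_orbit[OF assms(1,2) this] show ?thesis
      by (simp add: stokes_of_invariants)
  qed
  interpret closed_states Q "pfaffian t" "cotrace t"
  proof
    have "t \<in> Q" by (simp add: Q_def)
    then show "Q \<noteq> {}" by blast
    show "\<exists>u' v' w'. (y, w, y * w - v, u', v', w') \<in> Q" if "(x, y, z, u, v, w) \<in> Q" for x y z u v w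
      using state_drop[of y w v x z u] that by (simp add: Q_def)
    show "pfaffian r = pfaffian t" "cotrace r = cotrace t" if "r \<in> Q" for r
      using inv[OF that] by blast+
    show "pfaffian t \<noteq> 0" "twist_norm (pfaffian t) (cotrace t) 4 \<noteq> 0" by (rule p0 d0)+
  qed (simp_all only: Q_def mem_Collect_eq state_moves)
  show ?thesis using meets_representatives by (auto simp: Q_def)
qed

text \<open>An integral point of the variety determines the polynomial, so all integral points of one variety share
  \<open>cotrace\<close> and, up to sign, \<open>pfaffian\<close>.\<close>

lemma variety_polynomial:
  fixes p :: "int poly"
  assumes "stokes_of t \<in> stokes_variety 4 (map_poly of_int p)"
  defines "c \<equiv> 4 - cotrace t"
  shows "p = [:1, c, (pfaffian t)\<^sup>2 - 2 + 2 * c, c, 1:]" (is "p = ?q")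
proof -
  have "poly (map_poly of_int p) x = poly (map_poly of_int ?q) x" for x :: complex
    using assms(1) unfolding stokes_variety_4 stokes_of_invariants
    by (simp add: c_def algebra_simps power2_eq_square power3_eq_cube power4_eq_xxxx)
  then have "map_poly of_int p = (map_poly of_int ?q :: complex poly)"
    using poly_eq_poly_eq_iff by blast
  then have "of_int (coeff p n) = (of_int (coeff ?q n) :: complex)" for n
    by (metis coeff_map_poly of_int_0)
  then show ?thesis by (intro poly_eqI) (simp only: of_int_eq_iff)
qed

theorem theorem1p3:
  fixes p :: "int poly"
  assumes "monic p" and "degree p = 4"
    and "reciprocal_poly (map_poly of_int p)"
    and "discriminant p \<noteq> 0"
  shows "\<exists>\<O>. finite \<O> \<and> \<O> \<subseteq> orbits (braid_group 4) (stokes 4) (braid_action 4) \<and>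
    \<Union>\<O> = {s \<in> stokes_variety 4 (map_poly of_int p). integral_mat s}"
proof -
  define I where "I = {s \<in> stokes_variety 4 (map_poly of_int p). integral_mat s}"
  have I: "s \<in> stokes 4" if "s \<in> I" for s using that by (simp add: I_def stokes_variety_def)
  have "finite (braid_orbit ` I)"
  proof (cases "I = {}")
    case False
    then obtain t0 where t0: "stokes_of t0 \<in> I"
      using integral_stokes_cases I unfolding I_def by blast
    define R where "R = representatives (pfaffian t0) (cotrace t0) \<union> representatives (- pfaffian t0) (cotrace t0)"
    have nz: "pfaffian t \<noteq> 0 \<and> twist_norm (pfaffian t) (cotrace t) 4 \<noteq> 0" if "stokes_of t \<in> I" for t
    proof -
      have V: "stokes_of t \<in> stokes_variety 4 (map_poly of_int p)" using that by (simp add: I_def)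
      have p: "p = [:1, 4 - cotrace t, (pfaffian t)\<^sup>2 - 2 + 2 * (4 - cotrace t), 4 - cotrace t, 1:]"
        by (rule variety_polynomial[OF V])
      have "p \<noteq> 0" using assms(1) by auto
      then have no: "\<not> (poly p a = 0 \<and> poly (pderiv p) a = 0)" for a
        using discriminant_multiple_root assms(4) by blast
      \<comment> \<open>At \<open>1\<close> and \<open>-1\<close> a reciprocal quartic and its derivative vanish together.\<close>
      have "poly p (- 1) = (pfaffian t)\<^sup>2" "poly (pderiv p) (- 1) = - 2 * (pfaffian t)\<^sup>2"
        "poly p 1 = twist_norm (pfaffian t) (cotrace t) 4"
        "poly (pderiv p) 1 = 2 * twist_norm (pfaffian t) (cotrace t) 4"
        unfolding p by (simp_all add: pderiv_pCons twist_norm_def algebra_simps)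
      then show ?thesis using no[of 1] no[of "- 1"] by auto
    qed
    have "braid_orbit s \<in> (\<lambda>r. braid_orbit (stokes_of r)) ` R" if s: "s \<in> I" for s
    proof -
      obtain t where t: "s = stokes_of t"
        using integral_stokes_cases I s unfolding I_def by blast
      have "[:1, 4 - cotrace t, (pfaffian t)\<^sup>2 - 2 + 2 * (4 - cotrace t), 4 - cotrace t, 1:] =
          [:1, 4 - cotrace t0, (pfaffian t0)\<^sup>2 - 2 + 2 * (4 - cotrace t0), 4 - cotrace t0, 1:]"
        using variety_polynomial[of t p] variety_polynomial[of t0 p] s t0 t by (simp add: I_def)
      then have q: "cotrace t = cotrace t0" and "(pfaffian t)\<^sup>2 = (pfaffian t0)\<^sup>2" by simp_all
      then have pf: "pfaffian t = pfaffian t0 \<or> pfaffian t = - pfaffian t0" by (simp only: power2_eq_iff)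
      obtain r where r: "r \<in> representatives (pfaffian t) (cotrace t)"
          "braid_orbit (stokes_of t) = braid_orbit (stokes_of r)"
        using orbit_representative[of t "map_poly of_int p"] s nz[of t] unfolding t I_def by blast
      have "r \<in> R" using pf r(1) unfolding R_def q by (elim disjE) simp_all
      then show ?thesis unfolding t r(2) by (rule imageI)
    qed
    moreover have "finite R"
      unfolding R_def using nz[OF t0] by (simp add: finite_representatives)
    ultimately show ?thesis by (meson finite_imageI finite_subset image_subsetI)
  qed simp
  moreover have "braid_orbit ` I \<subseteq> orbits (braid_group 4) (stokes 4) (braid_action 4)"
    using I by (auto simp: orbits_def)
  moreover have "\<Union> (braid_orbit ` I) = I"
  proof (intro equalityI subsetI)
    fix s assume "s \<in> \<Union> (braid_orbit ` I)"
    then obtain s0 where "s0 \<in> I" "s \<in> braid_orbit s0" by blast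
    then show "s \<in> I"
      using integral_stokes_variety_orbit[of s0 "map_poly of_int p" s] unfolding I_def by simp
  next
    fix s assume "s \<in> I"
    then show "s \<in> \<Union> (braid_orbit ` I)" using braid4.orbit_refl[OF I] by blast
  qed
  ultimately show ?thesis unfolding I_def[symmetric] by blast
qed

end
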